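(* For every compact subset $\mathcal{U}\subseteq\mathcal{S}^2\cap\mathcal{O}$ there exist $c_1,c_2>0$ satisfying the following. Let $f_n$ be Kostlan's ensemble, $n\ge1$, $r\ge1/\sqrt n$, $u\ge1/\sqrt n$, let $(\{f_n\in A_i\})_{i\le k}$ be a collection of events in class $E(\mathcal{U},r,u)$, and let $t\ge c_1\sqrt{\log(2u\sqrt n)}\,e^{-c_2r^2n}$. Then $$\Pr\Big[\bigcap_{i\le k}\{f_n\in A_i\}\Big]\le\prod_{i\le k}\Pr\big[\{f_n+t\in A_i\}\big]+c_1k\,e^{-c_2t^2e^{c_2r^2n}}$$ and $$\Pr\Big[\bigcap_{i\le k}\{f_n\in A_i\}\Big]\le\Big(c_1\sup_{i\le k}\Pr\big[\{f_n+t\in A_i\}\big]\Big)^{c_2k}+c_1e^{-c_2kt^2e^{c_2r^2n}}.$$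
   Context: $\mathcal{S}^2\subset\mathbb{R}^3$ is the unit sphere with spherical distance $d_{\mathcal{S}^2}$, and $\mathcal{O}=\{x\in\mathbb{R}^3:x_i>0\text{ for all }i\}$ is the strictly positive orthant. Kostlan's ensemble is $f_n(x)=\sum_{|J|=n}\sqrt{\binom nJ}\,a_Jx^J$ restricted to $\mathcal{S}^2$, where $J\in\mathbb{Z}_{\ge0}^3$, $\binom nJ$ is the multinomial coefficient, and the $a_J$ are i.i.d. standard Gaussians; equivalently, $f_n$ is the centred Gaussian field on $\mathcal{S}^2$ with covariance $\langle x,y\rangle^n$. For $x\in\mathcal{S}^2$, $\mathcal{D}_u(x)$ denotes the spherical cap of radius $u$ centred at $x$. Class $E(\mathcal{U},r,u)$: let $f$ be a continuous Gaussian field on $\mathcal{S}^2$, $\mathcal{U}\subseteq\mathcal{S}^2$ a subset, and $r,u\in[0,\pi]$ constants. Let $(A_i)_{i\le k}$ be a collection of subsets of continuous functions on $\mathcal{S}^2$. The collection of events $(\{f\in A_i\})_{i\le k}$ is in class $E(\mathcal{U},r,u)$ if: (a) for each $i$ there exists a compact subset $U_i\subseteq\mathcal{U}$ such that $\{f\in A_i\}$ is measurable with respect to $f$ restricted to $U_i$, and each $U_i$ is contained in some spherical cap $\mathcal{D}_u(x)$; moreover, for distinct $i,j$, the subsets $U_i$ and $U_j$ are separated by distance at least $r$; (b) each $A_i$ is increasing in the sense that $\{f\in A_i\}\subseteq\{f+s\in A_i\}$ for all constants $s\ge0$.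
   Formalization: In (b), "increasing" is strengthened: each A_i must be stable under adding any nonnegative continuous function, not only constants s≥0 (with constants only the claim is false). In (a), A_i is measurable on path space w.r.t. the values at points of U_i. *)

theory Defs
  imports "HOL-Probability.Probability"
begin

abbreviation S2 :: "(real ^ 3) set" where
  "S2 \<equiv> sphere 0 1"

definition sphere_dist :: "real ^ 3 \<Rightarrow> real ^ 3 \<Rightarrow> real" where
  "sphere_dist x y = arccos (x \<bullet> y)"

definition sphere_cap :: "real \<Rightarrow> real ^ 3 \<Rightarrow> (real ^ 3) set" where
  "sphere_cap u x = {y \<in> S2. sphere_dist x y \<le> u}"

definition orthant :: "(real ^ 3) set" where
  "orthant = {x. \<forall>i. x $ i > 0}"

definition multi_indices :: "nat \<Rightarrow> (nat ^ 3) set" where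
  "multi_indices n = {J. (\<Sum>i\<in>UNIV. J $ i) = n}"

definition multinomial :: "nat \<Rightarrow> nat ^ 3 \<Rightarrow> real" where
  "multinomial n J = fact n / (\<Prod>i\<in>UNIV. fact (J $ i))"

definition kostlan :: "nat \<Rightarrow> (nat ^ 3 \<Rightarrow> 'w \<Rightarrow> real) \<Rightarrow> 'w \<Rightarrow> real ^ 3 \<Rightarrow> real" where
  "kostlan n a \<omega> x =
     (\<Sum>J\<in>multi_indices n. sqrt (multinomial n J) * a J \<omega> * (\<Prod>i\<in>UNIV. x $ i ^ (J $ i)))"

definition iid_std_gaussian :: "'w measure \<Rightarrow> 'i set \<Rightarrow> ('i \<Rightarrow> 'w \<Rightarrow> real) \<Rightarrow> bool" where
  "iid_std_gaussian M I a \<longleftrightarrow>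
     prob_space.indep_vars M (\<lambda>_. borel) a I \<and>
     (\<forall>J\<in>I. distributed M lborel (a J) std_normal_density)"

text \<open>Functions on the sphere are represented by total functions on the ambient space that are
  continuous on the sphere. Their values elsewhere are irrelevant below, because the events
  considered depend only on values at points of the sphere.\<close>

definition C_S2 :: "(real ^ 3 \<Rightarrow> real) set" where
  "C_S2 = {g. continuous_on S2 g}"

text \<open>The sigma-algebra on path space of events measurable with respect to the restriction of
  the path to \<open>U\<close>, i.e. the one generated by the evaluations at the points of \<open>U\<close>.
  Measurability has to be imposed on path space, not on the underlying probability space: a
  realisation of Kostlan's ensemble is a polynomial, hence determined by its restriction to any
  nonempty open part of the sphere, so the sigma-algebra generated on the probability space by
  the restriction of the field to such a part contains every event of the field.\<close>

definition restriction_algebra :: "(real ^ 3) set \<Rightarrow> (real ^ 3 \<Rightarrow> real) measure" where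
  "restriction_algebra U =
     vimage_algebra C_S2 (\<lambda>g. restrict g U) (Pi\<^sub>M U (\<lambda>_. borel))"

text \<open>Increasing with respect to the pointwise order: membership is preserved by adding any
  nonnegative continuous function \<open>s\<close>. Invariance under nonnegative constants only is not enough
  for a decoupling inequality, since it also holds for every event that depends only on
  increments \<open>g x - g y\<close>.\<close>

definition increasing_event :: "(real ^ 3 \<Rightarrow> real) set \<Rightarrow> bool" where
  "increasing_event A \<longleftrightarrow>
     (\<forall>g\<in>A. \<forall>s\<in>C_S2. (\<forall>x\<in>S2. s x \<ge> 0) \<longrightarrow> (\<lambda>x. g x + s x) \<in> A)"

text \<open>\<open>class_E \<U> r u k A\<close>: the collection of events \<open>{f \<in> A i}\<close>, \<open>1 \<le> i \<le> k\<close>, is in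
  the class \<open>E(\<U>, r, u)\<close>. The sets \<open>A i\<close> consist of continuous functions since the space of
  the restriction algebra is \<open>C_S2\<close>.\<close>

definition class_E ::
  "(real ^ 3) set \<Rightarrow> real \<Rightarrow> real \<Rightarrow> nat \<Rightarrow> (nat \<Rightarrow> (real ^ 3 \<Rightarrow> real) set) \<Rightarrow> bool" where
  "class_E \<U> r u k A \<longleftrightarrow>
     r \<in> {0..pi} \<and> u \<in> {0..pi} \<and>
     (\<exists>U :: nat \<Rightarrow> (real ^ 3) set.
        (\<forall>i\<in>{1..k}. compact (U i) \<and> U i \<subseteq> \<U> \<and>
           A i \<in> sets (restriction_algebra (U i)) \<and>
           (\<exists>x\<in>S2. U i \<subseteq> sphere_cap u x)) \<and>
        (\<forall>i\<in>{1..k}. \<forall>j\<in>{1..k}. i \<noteq> j \<longrightarrow>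
           (\<forall>x\<in>U i. \<forall>y\<in>U j. sphere_dist x y \<ge> r))) \<and>
     (\<forall>i\<in>{1..k}. increasing_event (A i))"

lemma increasing_event_add_const:
  assumes "increasing_event A" "g \<in> A" "s \<ge> 0"
  shows "(\<lambda>x. g x + s) \<in> A"
  using assms by (auto simp: increasing_event_def C_S2_def)

end

theory Submission
  imports Defs
begin

text \<open>
  For \<open>x\<close> on the sphere the squares of the coefficients
  \<open>sqrt (multinomial n J) * x^J\<close> of the field are the probabilities of \<open>J\<close> under the
  multinomial distribution with cell probabilities \<open>x\<^sub>i\<^sup>2\<close>. This distribution is
  concentrated around its mean with Gaussian fluctuations of order \<open>sqrt n\<close>, so the indices at
  distance more than a multiple of \<open>r * n\<close> from \<open>n * x\<^sup>2\<close> contribute to the variance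
  only an amount of order \<open>exp (- c * r\<^sup>2 * n)\<close> (\<open>kostlan_basis_tail\<close>). In a compact part of the
  positive orthant \<open>x\<close> is a Lipschitz function of \<open>x\<^sup>2\<close>; hence the indices near sets
  \<open>U\<^sub>i\<close>, \<open>U\<^sub>j\<close> at distance \<open>r\<close> are disjoint
  (\<open>disjoint_near_indices\<close>), and the fields truncated to these indices are independent. As the
  events are increasing, a truncation error that is uniformly at most \<open>t / 2\<close> is paid for by
  raising the level by \<open>t / 2\<close>; doing so once to pass to the truncated fields and once to return
  gives the first inequality, up to the probability that an error is large.

  For the second inequality it must be exponentially unlikely in \<open>card T\<close> that the errors are
  large simultaneously for all \<open>i\<close> in a set \<open>T\<close>, although the errors are dependent. They
  are almost orthogonal: a packing argument shows that the variance of a signed sum of errors, one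
  from each \<open>U\<^sub>i\<close>, is of order \<open>card T\<close> (\<open>far_coefficients_bound\<close>). The
  suprema over \<open>U\<^sub>i\<close> are reduced to single Gaussian variables in two steps. A net of
  polynomial size in \<open>u * sqrt n\<close> leaves cells of diameter of order \<open>1 / sqrt n\<close>; its
  cardinality is absorbed by the lower bound on \<open>t\<close>. Inside a cell the field is, up to a factor
  at most 1, a linear combination of exponentials \<open>exp (h \<bullet> y)\<close> with \<open>h\<close> in a cube,
  and its Taylor series in \<open>h\<close> has the form of a mean of Gaussian variables of uniformly
  bounded variance. Jensen's inequality then bounds exponential moments of the supremum
  (\<open>exponential_sum_sup_tail\<close>). The result is \<open>truncation_errors_tail\<close>; the elementary passage from it to both
  inequalities is \<open>decoupling_of_rare_errors\<close>.\<close>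

section \<open>The multinomial distribution behind the monomials\<close>

lemma prod_UNIV_3: "prod f (UNIV :: 3 set) = f 1 * f 2 * f 3"
  unfolding UNIV_3 by (simp add: ac_simps)

text \<open>The first two entries determine a multi-index, which turns sums over multi-indices into iterated
sums, where the binomial theorem applies.\<close>

lemma multi_indices_eq_image:
  "multi_indices n = (\<lambda>(i, j). vector [i, j, n - i - j]) ` (SIGMA i:{..n}. {..n - i})"
proof -
  have "J \<in> (\<lambda>(i, j). vector [i, j, n - i - j]) ` (SIGMA i:{..n}. {..n - i})"
    if "J \<in> multi_indices n" for J :: "nat ^ 3"
  proof -
    have "J = vector [J $ 1, J $ 2, n - J $ 1 - J $ 2]"
      using that by (auto simp: multi_indices_def sum_3 vec_eq_iff forall_3)
    moreover have "(J $ 1, J $ 2) \<in> (SIGMA i:{..n}. {..n - i})"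
      using that by (auto simp: multi_indices_def sum_3)
    ultimately show ?thesis by (metis (mono_tags, lifting) case_prod_conv image_eqI)
  qed
  moreover have "(\<lambda>(i, j). vector [i, j, n - i - j]) ` (SIGMA i:{..n}. {..n - i}) \<subseteq> multi_indices n"
    by (auto simp: multi_indices_def sum_3)
  ultimately show ?thesis by blast
qed

lemma finite_multi_indices [simp]: "finite (multi_indices n)"
  by (simp add: multi_indices_eq_image)

lemma multinomial_nonneg: "multinomial n J \<ge> 0"
  by (simp add: multinomial_def prod_nonneg)

lemma multinomial_theorem:
  fixes x :: "real ^ 3"
  shows "(\<Sum>i\<in>UNIV. x $ i) ^ n = (\<Sum>J\<in>multi_indices n. multinomial n J * (\<Prod>i\<in>UNIV. x $ i ^ (J $ i)))"
proof -
  let ?T = "\<lambda>J. multinomial n J * (\<Prod>i\<in>UNIV. x $ i ^ (J $ i))"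
  let ?v = "\<lambda>(i, j). vector [i, j, n - i - j] :: nat ^ 3"
  have inj: "inj_on ?v (SIGMA i:{..n}. {..n - i})"
    by (auto simp: inj_on_def vec_eq_iff forall_3)
  have "(\<Sum>i\<in>UNIV. x $ i) ^ n = (x $ 1 + (x $ 2 + x $ 3)) ^ n"
    by (simp add: sum_3 add.assoc)
  also have "\<dots> = (\<Sum>i\<le>n. of_nat (n choose i) * x $ 1 ^ i *
      (\<Sum>j\<le>n - i. of_nat (n - i choose j) * x $ 2 ^ j * x $ 3 ^ (n - i - j)))"
    by (simp add: binomial_ring)
  also have "\<dots> = (\<Sum>i\<le>n. \<Sum>j\<le>n - i. ?T (?v (i, j)))"
  proof (unfold sum_distrib_left, intro sum.cong refl)
    fix i j assume "i \<in> {..n}" "j \<in> {..n - i}"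
    then have "real (n choose i) * real (n - i choose j) = fact n / (fact i * fact j * fact (n - i - j))"
      by (simp add: binomial_fact)
    then have "multinomial n (?v (i, j)) = real (n choose i) * real (n - i choose j)"
      by (simp add: multinomial_def prod_UNIV_3)
    then show "real (n choose i) * x $ 1 ^ i * (real (n - i choose j) * x $ 2 ^ j * x $ 3 ^ (n - i - j))
       = ?T (?v (i, j))"
      by (simp add: prod_UNIV_3)
  qed
  also have "\<dots> = (\<Sum>p\<in>(SIGMA i:{..n}. {..n - i}). ?T (?v p))"
    by (simp add: sum.Sigma case_prod_unfold)
  also have "\<dots> = (\<Sum>J\<in>multi_indices n. ?T J)"
    unfolding multi_indices_eq_image by (subst sum.reindex[OF inj]) (simp add: o_def)
  finally show ?thesis .
qed

text \<open>For a centred random variable the linear term has mean zero, so this bound converts directly into a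
sub-Gaussian moment generating function.\<close>

lemma exp_le_add_exp_square: "exp s \<le> s + exp (s\<^sup>2)" for s :: real
proof -
  have 1: "1 + s\<^sup>2 \<le> exp (s\<^sup>2)" by (rule exp_ge_add_one_self)
  consider "s > 1" | "0 \<le> s" "s \<le> 1" | "-1 \<le> s" "s < 0" | "s < -1" by linarith
  then show ?thesis
  proof cases
    case 1
    then have "s \<le> s\<^sup>2" by (simp add: power2_eq_square)
    then have "exp s \<le> exp (s\<^sup>2)" by simp
    with 1 show ?thesis by linarith
  next
    case 2
    then show ?thesis using exp_bound[of s] 1 by linarith
  next
    case 3
    define v where "v = - s"
    have v: "v > 0" using 3 v_def by simp
    have "1 + v + v\<^sup>2 / 2 \<le> exp v" using exp_lower_Taylor_quadratic[of v] v by simp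
    moreover have "1 \<le> (1 - v + v\<^sup>2) * (1 + v + v\<^sup>2 / 2)"
    proof -
      have "(1 - v + v\<^sup>2) * (1 + v + v\<^sup>2 / 2) = 1 + v\<^sup>2 / 2 + v ^ 3 / 2 + v ^ 4 / 2"
        by (simp add: field_simps power2_eq_square power3_eq_cube power4_eq_xxxx)
      with v show ?thesis by simp
    qed
    moreover have "0 \<le> 1 - v + v\<^sup>2"
      using zero_le_power2[of "v - 1/2"] by (simp add: power2_eq_square algebra_simps)
    ultimately have "1 \<le> (1 - v + v\<^sup>2) * exp v"
      using mult_left_mono[of "1 + v + v\<^sup>2 / 2" "exp v" "1 - v + v\<^sup>2"] by linarith
    then have "exp (- v) \<le> 1 - v + v\<^sup>2"
      by (simp add: exp_minus field_simps)
    then have "exp s \<le> 1 + s + s\<^sup>2" by (simp add: v_def)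
    with 1 show ?thesis by linarith
  next
    case 4
    have "exp s \<le> 1" using 4 by simp
    moreover have "- s \<le> s\<^sup>2"
      using 4 mult_nonneg_nonneg[of "- 1 - s" "- s"] by (simp add: power2_eq_square algebra_simps)
    ultimately show ?thesis using 1 by linarith
  qed
qed

text \<open>For \<open>x\<close> on the sphere, the square is the probability of \<open>J\<close> under the multinomial distribution with
\<open>n\<close> trials and cell probabilities \<open>x\<^sub>1\<^sup>2, x\<^sub>2\<^sup>2, x\<^sub>3\<^sup>2\<close>.\<close>

definition kostlan_basis :: "nat \<Rightarrow> nat ^ 3 \<Rightarrow> real ^ 3 \<Rightarrow> real" where
  "kostlan_basis n J x = sqrt (multinomial n J) * (\<Prod>i\<in>UNIV. x $ i ^ (J $ i))"

text \<open>The multinomial vector centred at its mean, on the scale of its fluctuations.\<close>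

definition deviation :: "nat \<Rightarrow> nat ^ 3 \<Rightarrow> real ^ 3 \<Rightarrow> real ^ 3" where
  "deviation n J x = (\<chi> i. (real (J $ i) - real n * (x $ i)\<^sup>2) / sqrt (real n))"

lemma kostlan_basis_square:
  "(kostlan_basis n J x)\<^sup>2 = multinomial n J * (\<Prod>i\<in>UNIV. ((x $ i)\<^sup>2) ^ (J $ i))"
  by (simp add: kostlan_basis_def power_mult_distrib multinomial_nonneg prod_UNIV_3
      flip: power_mult) (simp add: mult.commute)

lemma sum_squares_sphere: "x \<in> S2 \<Longrightarrow> (\<Sum>i\<in>UNIV. (x $ i)\<^sup>2) = 1"
  by (simp add: norm_eq_1 inner_vec_def power2_eq_square)

text \<open>Exponential tilting multiplies each cell probability by an exponential, so the multinomial theorem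
evaluates the generating function as an \<open>n\<close>-th power. Once the tilt is centred, each factor is
at most \<open>exp (\<tau>\<^sup>2 / n)\<close>.\<close>

lemma kostlan_basis_mgf:
  assumes "x \<in> S2" "n \<ge> 1"
  shows "(\<Sum>J\<in>multi_indices n. (kostlan_basis n J x)\<^sup>2 * exp (\<tau> * deviation n J x $ j)) \<le> exp (\<tau>\<^sup>2)"
proof -
  define p where "p i = (x $ i)\<^sup>2" for i
  define s where "s i = \<tau> / sqrt n * (of_bool (i = j) - p j)" for i
  have p: "p i \<ge> 0" for i by (simp add: p_def)
  have sum_p: "(\<Sum>i\<in>UNIV. p i) = 1" using assms by (simp add: sum_squares_sphere p_def)
  have p1: "p i \<le> 1" for i using sum_p p by (metis finite member_le_sum UNIV_I)
  have s2: "(s i)\<^sup>2 \<le> \<tau>\<^sup>2 / n" for i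
  proof -
    have "\<bar>of_bool (i = j) - p j\<bar> \<le> 1" using p[of j] p1[of j] by auto
    then have "(of_bool (i = j) - p j)\<^sup>2 \<le> 1" by (simp add: abs_square_le_1)
    then have "\<tau>\<^sup>2 / n * (of_bool (i = j) - p j)\<^sup>2 \<le> \<tau>\<^sup>2 / n * 1" by (intro mult_left_mono) auto
    then show ?thesis by (simp add: s_def power_mult_distrib power_divide)
  qed
  have centred: "(\<Sum>i\<in>UNIV. p i * s i) = 0"
  proof -
    have "(\<Sum>i\<in>UNIV. p i * s i) = \<tau> / sqrt n * ((\<Sum>i\<in>UNIV. p i * of_bool (i = j)) - (\<Sum>i\<in>UNIV. p i) * p j)"
      unfolding s_def sum_distrib_left sum_distrib_right right_diff_distrib sum_subtractf
      by (simp add: mult_ac del: sum_mult_of_bool_eq)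
    also have "\<dots> = 0" by (simp add: sum_p)
    finally show ?thesis .
  qed
  have eq: "(kostlan_basis n J x)\<^sup>2 * exp (\<tau> * deviation n J x $ j) =
      multinomial n J * (\<Prod>i\<in>UNIV. (\<chi> i. p i * exp (s i)) $ i ^ (J $ i))"
    if "J \<in> multi_indices n" for J
  proof -
    have n: "(\<Sum>i\<in>UNIV. real (J $ i)) = n"
      using that by (simp add: multi_indices_def flip: of_nat_sum)
    have "\<tau> * deviation n J x $ j = \<tau> / sqrt n * (real (J $ j) - n * p j)"
      by (simp add: deviation_def p_def)
    also have "\<dots> = \<tau> / sqrt n * ((\<Sum>i\<in>UNIV. real (J $ i) * of_bool (i = j)) - (\<Sum>i\<in>UNIV. real (J $ i)) * p j)"
      by (simp add: n)
    also have "\<dots> = (\<Sum>i\<in>UNIV. real (J $ i) * s i)"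
      unfolding s_def sum_distrib_left sum_distrib_right right_diff_distrib sum_subtractf
      by (simp add: mult_ac del: sum_mult_of_bool_eq)
    finally have "\<tau> * deviation n J x $ j = (\<Sum>i\<in>UNIV. real (J $ i) * s i)" .
    then show ?thesis
      by (simp add: kostlan_basis_square p_def exp_sum power_mult_distrib prod.distrib
          flip: exp_of_nat_mult)
  qed
  have "(\<Sum>J\<in>multi_indices n. (kostlan_basis n J x)\<^sup>2 * exp (\<tau> * deviation n J x $ j))
      = (\<Sum>i\<in>UNIV. p i * exp (s i)) ^ n"
    using multinomial_theorem[of "\<chi> i. p i * exp (s i)" n] by (simp add: eq)
  also have "\<dots> \<le> (exp (\<tau>\<^sup>2 / n)) ^ n"
  proof (rule power_mono)
    have "(\<Sum>i\<in>UNIV. p i * exp (s i)) \<le> (\<Sum>i\<in>UNIV. p i * (s i + exp (\<tau>\<^sup>2 / n)))"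
    proof (intro sum_mono mult_left_mono p)
      fix i show "exp (s i) \<le> s i + exp (\<tau>\<^sup>2 / n)"
        using exp_le_add_exp_square[of "s i"] exp_le_cancel_iff[THEN iffD2, OF s2[of i]] by linarith
    qed
    also have "\<dots> = exp (\<tau>\<^sup>2 / n)"
      by (simp add: distrib_left sum.distrib centred sum_p flip: sum_distrib_right)
    finally show "(\<Sum>i\<in>UNIV. p i * exp (s i)) \<le> exp (\<tau>\<^sup>2 / n)" .
  qed (simp add: p sum_nonneg)
  also have "\<dots> = exp (\<tau>\<^sup>2)" using assms by (simp flip: exp_of_nat_mult)
  finally show ?thesis .
qed

text \<open>Reduces exponential moments of a Euclidean norm to those of single coordinates: the norm is at most
three times the largest coordinate, and the maximum over coordinates and signs is at most the sum.\<close>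

lemma exp_norm_le_sum_exp:
  fixes y :: "real ^ 3"
  assumes "a \<ge> 0"
  shows "exp (a * norm y) \<le> (\<Sum>j\<in>UNIV. exp (3 * a * y $ j) + exp (- (3 * a) * y $ j))"
proof -
  obtain j where j: "\<And>i. \<bar>y $ i\<bar> \<le> \<bar>y $ j\<bar>"
  proof -
    have "Max (range (\<lambda>i. \<bar>y $ i\<bar>)) \<in> range (\<lambda>i. \<bar>y $ i\<bar>)" by (rule Max_in) auto
    then obtain j where "Max (range (\<lambda>i. \<bar>y $ i\<bar>)) = \<bar>y $ j\<bar>" by blast
    moreover have "\<bar>y $ i\<bar> \<le> Max (range (\<lambda>i. \<bar>y $ i\<bar>))" for i by (rule Max_ge) auto
    ultimately show ?thesis using that[of j] by auto
  qed
  have "norm y \<le> (\<Sum>i\<in>UNIV. \<bar>y $ i\<bar>)" by (rule norm_le_l1_cart)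
  also have "\<dots> \<le> (\<Sum>i\<in>(UNIV :: 3 set). \<bar>y $ j\<bar>)" by (intro sum_mono j)
  finally have "a * norm y \<le> a * (3 * \<bar>y $ j\<bar>)" using assms by (intro mult_left_mono) simp_all
  then have "a * norm y \<le> 3 * a * \<bar>y $ j\<bar>" by simp
  then have "exp (a * norm y) \<le> exp (3 * a * \<bar>y $ j\<bar>)" by simp
  also have "\<dots> \<le> exp (3 * a * y $ j) + exp (- (3 * a) * y $ j)"
    by (cases "y $ j \<ge> 0") (auto intro: add_increasing add_increasing2)
  also have "\<dots> \<le> (\<Sum>j\<in>UNIV. exp (3 * a * y $ j) + exp (- (3 * a) * y $ j))"
    by (rule member_le_sum) (auto intro: add_nonneg_nonneg)
  finally show ?thesis .
qed

text \<open>A Chernoff bound. The weight \<open>exp (13 * norm _)\<close> is the room needed later: a factor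
\<open>exp (6 * norm _)\<close>, squared, comes from moving inside a cell, and one more factor
\<open>exp (norm _)\<close> from a weighted Cauchy-Schwarz inequality.\<close>

lemma kostlan_basis_tail:
  assumes "x \<in> S2" "n \<ge> 1" "\<rho> \<ge> 0"
  shows "(\<Sum>J\<in>{J \<in> multi_indices n. norm (deviation n J x) > \<rho>}.
            (kostlan_basis n J x)\<^sup>2 * exp (13 * norm (deviation n J x))) \<le> 6 * exp 3042 * exp (- (\<rho>\<^sup>2 / 72))"
proof -
  \<comment> \<open>Chernoff parameter: \<open>18 * b\<^sup>2 - b * \<rho>\<close> is minimal at \<open>\<rho> / 36\<close>, with value \<open>- \<rho>\<^sup>2 / 72\<close>.\<close>
  define b where "b = \<rho> / 36"
  define a where "a = 13 + b"
  have ab: "b \<ge> 0" "a \<ge> 0" using assms by (auto simp: a_def b_def)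
  have "(\<Sum>J\<in>{J \<in> multi_indices n. norm (deviation n J x) > \<rho>}.
            (kostlan_basis n J x)\<^sup>2 * exp (13 * norm (deviation n J x)))
     \<le> (\<Sum>J\<in>{J \<in> multi_indices n. norm (deviation n J x) > \<rho>}.
            (kostlan_basis n J x)\<^sup>2 * (exp (- b * \<rho>) * exp (a * norm (deviation n J x))))"
  proof (intro sum_mono mult_left_mono)
    fix J assume "J \<in> {J \<in> multi_indices n. norm (deviation n J x) > \<rho>}"
    then have "b * \<rho> \<le> b * norm (deviation n J x)" using ab by (intro mult_left_mono) auto
    then show "exp (13 * norm (deviation n J x)) \<le> exp (- b * \<rho>) * exp (a * norm (deviation n J x))"
      by (simp add: a_def algebra_simps flip: exp_add)
  qed auto
  also have "\<dots> \<le> (\<Sum>J\<in>multi_indices n.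
            (kostlan_basis n J x)\<^sup>2 * (exp (- b * \<rho>) * exp (a * norm (deviation n J x))))"
    by (intro sum_mono2) auto
  also have "\<dots> \<le> (\<Sum>J\<in>multi_indices n. (kostlan_basis n J x)\<^sup>2 * (exp (- b * \<rho>) *
      (\<Sum>j\<in>UNIV. exp (3 * a * deviation n J x $ j) + exp (- (3 * a) * deviation n J x $ j))))"
    using ab by (intro sum_mono mult_left_mono exp_norm_le_sum_exp) auto
  also have "\<dots> = exp (- b * \<rho>) * (\<Sum>j\<in>UNIV.
      (\<Sum>J\<in>multi_indices n. (kostlan_basis n J x)\<^sup>2 * exp (3 * a * deviation n J x $ j)) +
      (\<Sum>J\<in>multi_indices n. (kostlan_basis n J x)\<^sup>2 * exp (- (3 * a) * deviation n J x $ j)))"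
    by (simp add: sum_distrib_left sum.distrib algebra_simps sum.swap[of _ UNIV])
  also have "\<dots> \<le> exp (- b * \<rho>) * (\<Sum>j\<in>(UNIV :: 3 set). exp ((3 * a)\<^sup>2) + exp ((- (3 * a))\<^sup>2))"
    using assms by (intro mult_left_mono sum_mono add_mono kostlan_basis_mgf) auto
  also have "\<dots> = 6 * exp ((3 * a)\<^sup>2 - b * \<rho>)" by (simp add: exp_diff exp_minus field_simps)
  also have "\<dots> \<le> 6 * exp (3042 - \<rho>\<^sup>2 / 72)"
  proof -
    have "(3 * a)\<^sup>2 \<le> 3042 + 18 * b\<^sup>2"
      using zero_le_power2[of "13 - b"] by (simp add: a_def power2_eq_square algebra_simps)
    then show ?thesis by (simp add: b_def power2_eq_square algebra_simps)
  qed
  also have "\<dots> = 6 * exp 3042 * exp (- (\<rho>\<^sup>2 / 72))" by (simp only: diff_conv_add_uminus exp_add mult.assoc)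
  finally show ?thesis .
qed

section \<open>Almost orthogonality of the truncation errors\<close>

text \<open>A packing bound. Each point of an \<open>s\<close>-separated set has its own cube of the grid of side
\<open>s / 3\<close>, so the sum is dominated by a product of three geometric series.\<close>

lemma separated_exp_sum_bounded:
  assumes "s > 0"
  shows "\<exists>K>0. \<forall>(T :: nat set) (q :: nat \<Rightarrow> real ^ 3) z. finite T \<longrightarrow>
    (\<forall>i\<in>T. \<forall>j\<in>T. i \<noteq> j \<longrightarrow> norm (q i - q j) \<ge> s) \<longrightarrow> (\<Sum>i\<in>T. exp (- norm (z - q i))) \<le> K"
proof -
  define \<gamma> where "\<gamma> = exp (- (s / 9))"
  have \<gamma>: "0 < \<gamma>" "\<gamma> < 1" using assms by (auto simp: \<gamma>_def)
  define g :: "int \<Rightarrow> real" where "g m = \<gamma> ^ nat \<bar>m\<bar> / \<gamma>" for m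
  have g_nonneg: "g m \<ge> 0" for m using \<gamma> by (simp add: g_def)
  have g_sum: "(\<Sum>m\<in>{- int N..int N}. g m) \<le> 2 / (1 - \<gamma>) / \<gamma>" for N
  proof -
    have "(\<Sum>m\<in>{- int N..int N}. \<gamma> ^ nat \<bar>m\<bar>) \<le> (\<Sum>m\<in>int ` {..N} \<union> (\<lambda>k. - int k) ` {..N}. \<gamma> ^ nat \<bar>m\<bar>)"
    proof (rule sum_mono2)
      show "{- int N..int N} \<subseteq> int ` {..N} \<union> (\<lambda>k. - int k) ` {..N}"
      proof
        fix m assume "m \<in> {- int N..int N}"
        then have "nat \<bar>m\<bar> \<in> {..N}" "m = int (nat \<bar>m\<bar>) \<or> m = - int (nat \<bar>m\<bar>)" by auto
        then show "m \<in> int ` {..N} \<union> (\<lambda>k. - int k) ` {..N}" by blast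
      qed
    qed (use \<gamma> in auto)
    also have "\<dots> \<le> (\<Sum>m\<in>int ` {..N}. \<gamma> ^ nat \<bar>m\<bar>) + (\<Sum>m\<in>(\<lambda>k. - int k) ` {..N}. \<gamma> ^ nat \<bar>m\<bar>)"
      using \<gamma> by (subst sum_Un) (auto intro!: sum_nonneg)
    also have "\<dots> = 2 * (\<Sum>k\<le>N. \<gamma> ^ k)"
      by (simp add: sum.reindex inj_on_def)
    also have "\<dots> \<le> 2 * (1 / (1 - \<gamma>))"
    proof -
      have "(\<Sum>k\<le>N. \<gamma> ^ k) \<le> (\<Sum>k. \<gamma> ^ k)" using \<gamma> by (intro sum_le_suminf summable_geometric) auto
      then show ?thesis using \<gamma> by (simp add: suminf_geometric)
    qed
    finally show ?thesis
      unfolding g_def sum_divide_distrib[symmetric] using \<gamma> by (intro divide_right_mono) auto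
  qed
  have main: "(\<Sum>i\<in>T. exp (- norm (z - q i))) \<le> (2 / (1 - \<gamma>) / \<gamma>) ^ 3"
    if T: "finite T" and sep: "\<forall>i\<in>T. \<forall>j\<in>T. i \<noteq> j \<longrightarrow> norm (q i - q j) \<ge> s"
    for T :: "nat set" and q :: "nat \<Rightarrow> real ^ 3" and z
  proof -
    \<comment> \<open>The grid is centred at \<open>z\<close>; side \<open>s / 3\<close> makes the diagonal, measured in the 1-norm, equal to \<open>s\<close>.\<close>
    define c where "c i k = \<lfloor>3 * (z - q i) $ k / s\<rfloor>" for i k
    define m where "m i = (c i 1, c i 2, c i 3)" for i
    define N where "N = nat (\<Sum>i\<in>T. \<Sum>k\<in>UNIV. \<bar>c i k\<bar>)"
    have cN: "c i k \<in> {- int N..int N}" if "i \<in> T" for i k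
    proof -
      have "\<bar>c i k\<bar> \<le> (\<Sum>k\<in>UNIV. \<bar>c i k\<bar>)" by (rule member_le_sum) auto
      also have "\<dots> \<le> (\<Sum>i\<in>T. \<Sum>k\<in>UNIV. \<bar>c i k\<bar>)" using that T by (intro member_le_sum) (auto intro: sum_nonneg)
      finally show ?thesis by (auto simp: N_def)
    qed
    have inj: "inj_on m T"
    proof (rule inj_onI, rule ccontr)
      fix i j assume ij: "i \<in> T" "j \<in> T" "m i = m j" "i \<noteq> j"
      then have c: "c i k = c j k" for k using exhaust_3[of k] by (auto simp: m_def)
      have "\<bar>(q i - q j) $ k\<bar> < s / 3" for k
      proof -
        define a b where ab: "a = (z - q i) $ k" "b = (z - q j) $ k"
        have "\<bar>3 * a / s - 3 * b / s\<bar> < 1"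
          using c[of k] unfolding c_def ab by linarith
        moreover have "3 * a / s - 3 * b / s = 3 / s * (a - b)" by (simp add: right_diff_distrib)
        ultimately have "\<bar>3 / s * (a - b)\<bar> < 1" by metis
        then have "3 / s * \<bar>a - b\<bar> < 1" unfolding abs_mult using assms by simp
        then have "\<bar>a - b\<bar> < s / 3" using assms by (simp add: field_simps)
        then show ?thesis by (simp add: ab abs_minus_commute)
      qed
      then have "(\<Sum>k\<in>UNIV. \<bar>(q i - q j) $ k\<bar>) < (\<Sum>k\<in>(UNIV :: 3 set). s / 3)" by (intro sum_strict_mono) auto
      then have "norm (q i - q j) < s" using norm_le_l1_cart[of "q i - q j"] by simp
      with sep ij show False by force
    qed
    have "exp (- norm (z - q i)) \<le> g (c i 1) * g (c i 2) * g (c i 3)" for i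
    proof -
      have *: "exp (- (\<bar>(z - q i) $ k\<bar> / 3)) \<le> g (c i k)" for k
      proof -
        define d where "d = (z - q i) $ k"
        have "real_of_int \<bar>c i k\<bar> - 1 \<le> \<bar>3 * d / s\<bar>"
          unfolding c_def d_def by linarith
        also have "\<dots> = 9 / s * (\<bar>d\<bar> / 3)" using assms by (simp add: abs_mult)
        finally have "s / 9 * (real_of_int \<bar>c i k\<bar> - 1) \<le> s / 9 * (9 / s * (\<bar>d\<bar> / 3))"
          using assms by (intro mult_left_mono) auto
        then have "s / 9 * (real_of_int \<bar>c i k\<bar> - 1) \<le> \<bar>(z - q i) $ k\<bar> / 3"
          using assms by (simp add: d_def)
        moreover have "g (c i k) = exp (- (s / 9 * (real_of_int \<bar>c i k\<bar> - 1)))"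
        proof -
          have "g (c i k) = exp (real (nat \<bar>c i k\<bar>) * - (s / 9) - - (s / 9))"
            unfolding g_def \<gamma>_def exp_diff exp_of_nat_mult ..
          then show ?thesis by (simp add: field_simps)
        qed
        ultimately show ?thesis by simp
      qed
      have "\<bar>(z - q i) $ 1\<bar> + \<bar>(z - q i) $ 2\<bar> + \<bar>(z - q i) $ 3\<bar> \<le> 3 * norm (z - q i)"
        using component_le_norm_cart[of "z - q i" 1] component_le_norm_cart[of "z - q i" 2]
          component_le_norm_cart[of "z - q i" 3] by linarith
      then have "exp (- norm (z - q i)) \<le> exp (- (\<bar>(z - q i) $ 1\<bar> / 3) + - (\<bar>(z - q i) $ 2\<bar> / 3) + - (\<bar>(z - q i) $ 3\<bar> / 3))"
        by simp
      also have "\<dots> = exp (- (\<bar>(z - q i) $ 1\<bar> / 3)) * exp (- (\<bar>(z - q i) $ 2\<bar> / 3)) * exp (- (\<bar>(z - q i) $ 3\<bar> / 3))"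
        by (simp only: exp_add)
      also have "\<dots> \<le> g (c i 1) * g (c i 2) * g (c i 3)"
        by (intro mult_mono *) (auto intro: g_nonneg mult_nonneg_nonneg)
      finally show ?thesis .
    qed
    then have "(\<Sum>i\<in>T. exp (- norm (z - q i))) \<le> (\<Sum>i\<in>T. (\<lambda>(a, b, c). g a * g b * g c) (m i))"
      by (intro sum_mono) (simp add: m_def)
    also have "\<dots> = (\<Sum>p\<in>m ` T. (\<lambda>(a, b, c). g a * g b * g c) p)"
      using inj by (simp add: sum.reindex)
    also have "\<dots> \<le> (\<Sum>p\<in>{- int N..int N} \<times> {- int N..int N} \<times> {- int N..int N}. (\<lambda>(a, b, c). g a * g b * g c) p)"
    proof (rule sum_mono2)
      show "m ` T \<subseteq> {- int N..int N} \<times> {- int N..int N} \<times> {- int N..int N}"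
        using cN unfolding m_def by blast
    qed (use g_nonneg in auto)
    also have "\<dots> = (\<Sum>m\<in>{- int N..int N}. g m) ^ 3"
      by (simp add: sum.cartesian_product[symmetric] power3_eq_cube mult.assoc
          flip: sum_distrib_left sum_distrib_right)
    also have "\<dots> \<le> (2 / (1 - \<gamma>) / \<gamma>) ^ 3"
      by (intro power_mono g_sum sum_nonneg g_nonneg)
    finally show ?thesis .
  qed
  show ?thesis
    by (rule exI[of _ "(2 / (1 - \<gamma>) / \<gamma>) ^ 3"]) (use \<gamma> main in auto)
qed

text \<open>The mean of the multinomial vector in units of its fluctuations. Index sets of different events are
told apart through these points.\<close>

definition centre :: "nat \<Rightarrow> real ^ 3 \<Rightarrow> real ^ 3" where
  "centre n x = (\<chi> i. sqrt (real n) * (x $ i)\<^sup>2)"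

lemma deviation_eq: "deviation n J x = (\<chi> i. real (J $ i) / sqrt (real n)) - centre n x"
  by (simp add: deviation_def centre_def vec_eq_iff diff_divide_distrib real_div_sqrt
      flip: times_divide_eq_left)

text \<open>The errors at the points \<open>x i\<close> share coefficients and are correlated, but an index contributes
substantially to the errors at few points only. Cauchy-Schwarz with the weights
\<open>exp (- norm (deviation n J (x i)))\<close>, whose sum over \<open>i\<close> is at most \<open>K\<close>
(for separated centres, by packing), shows that the variance of the sum of the errors grows like
\<open>card T\<close> and not like its square. This gain is what makes the second error
term exponentially small in \<open>k\<close>.\<close>

lemma far_coefficients_bound:
  assumes K: "\<And>z. (\<Sum>i\<in>T. exp (- norm (z - centre n (x i)))) \<le> K"
    and T: "finite T" "\<And>i. i \<in> T \<Longrightarrow> x i \<in> S2" and n: "n \<ge> 1" and \<rho>: "\<rho> \<ge> 0"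
  shows "(\<Sum>J\<in>multi_indices n. (\<Sum>i\<in>T. of_bool (norm (deviation n J (x i)) > \<rho>) *
            (\<bar>kostlan_basis n J (x i)\<bar> * (2 * exp (6 * norm (deviation n J (x i))))))\<^sup>2)
    \<le> 24 * exp 3042 * K * card T * exp (- (\<rho>\<^sup>2 / 72))"
proof -
  define Y where "Y i J = norm (deviation n J (x i))" for i J
  define b where "b i J = of_bool (Y i J > \<rho>) * (\<bar>kostlan_basis n J (x i)\<bar> * (2 * exp (6 * Y i J)))" for i J
  have K0: "K \<ge> 0" using K[of 0] by (meson exp_ge_zero order_trans sum_nonneg)
  have "(\<Sum>i\<in>T. b i J)\<^sup>2 \<le> K * (\<Sum>i\<in>T. of_bool (Y i J > \<rho>) * (4 * ((kostlan_basis n J (x i))\<^sup>2 * exp (13 * Y i J))))" for J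
  proof -
    have "(\<Sum>i\<in>T. b i J)\<^sup>2 = (\<Sum>i\<in>T. exp (- (Y i J / 2)) * (exp (Y i J / 2) * b i J))\<^sup>2"
      by (simp flip: mult.assoc exp_add)
    also have "\<dots> \<le> (\<Sum>i\<in>T. (exp (- (Y i J / 2)))\<^sup>2) * (\<Sum>i\<in>T. (exp (Y i J / 2) * b i J)\<^sup>2)"
      by (rule Cauchy_Schwarz_ineq_sum)
    also have "\<dots> = (\<Sum>i\<in>T. exp (- Y i J)) * (\<Sum>i\<in>T. exp (Y i J) * (b i J)\<^sup>2)"
      by (simp add: power_mult_distrib flip: exp_double)
    also have "\<dots> \<le> K * (\<Sum>i\<in>T. exp (Y i J) * (b i J)\<^sup>2)"
      using K[of "\<chi> i. real (J $ i) / sqrt (real n)"]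
      by (intro mult_right_mono) (auto intro!: sum_nonneg simp: Y_def deviation_eq)
    also have "(\<Sum>i\<in>T. exp (Y i J) * (b i J)\<^sup>2) =
        (\<Sum>i\<in>T. of_bool (Y i J > \<rho>) * (4 * ((kostlan_basis n J (x i))\<^sup>2 * exp (13 * Y i J))))"
    proof (intro sum.cong refl)
      fix i
      have "exp (13 * Y i J) = exp (Y i J) * (exp (6 * Y i J))\<^sup>2"
        by (simp flip: exp_double exp_add)
      then show "exp (Y i J) * (b i J)\<^sup>2 =
          of_bool (Y i J > \<rho>) * (4 * ((kostlan_basis n J (x i))\<^sup>2 * exp (13 * Y i J)))"
        by (simp add: b_def power_mult_distrib)
    qed
    finally show ?thesis .
  qed
  then have "(\<Sum>J\<in>multi_indices n. (\<Sum>i\<in>T. b i J)\<^sup>2) \<le>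
     (\<Sum>J\<in>multi_indices n. K * (\<Sum>i\<in>T. of_bool (Y i J > \<rho>) * (4 * ((kostlan_basis n J (x i))\<^sup>2 * exp (13 * Y i J)))))"
    by (rule sum_mono)
  also have "\<dots> = K * (\<Sum>i\<in>T. 4 * (\<Sum>J\<in>{J \<in> multi_indices n. Y i J > \<rho>}. (kostlan_basis n J (x i))\<^sup>2 * exp (13 * Y i J)))"
    unfolding sum_distrib_left
    by (subst sum.swap) (simp add: sum.inter_filter of_bool_def if_distrib if_distribR cong: if_cong)
  also have "\<dots> \<le> K * (\<Sum>i\<in>T. 4 * (6 * exp 3042 * exp (- (\<rho>\<^sup>2 / 72))))"
    using K0 kostlan_basis_tail[OF T(2) n \<rho>] unfolding Y_def by (intro mult_left_mono sum_mono) auto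
  also have "\<dots> = 24 * exp 3042 * K * card T * exp (- (\<rho>\<^sup>2 / 72))" by simp
  finally show ?thesis unfolding b_def Y_def .
qed

section \<open>Suprema over a cell by Taylor expansion\<close>

text \<open>A probability distribution on multi-indices: the total degree is geometric with ratio one half, and
given the degree the multi-index is multinomial with equal cell probabilities. The Taylor series of
the exponential becomes a mean under it, with coefficients \<open>taylor_coeff\<close> that are
bounded uniformly in the multi-index.\<close>

definition taylor_weight :: "nat \<Rightarrow> nat ^ 3 \<Rightarrow> real" where
  "taylor_weight m \<alpha> = multinomial m \<alpha> / 3 ^ m / 2 ^ Suc m"

text \<open>The term of the Taylor series at \<open>\<alpha>\<close>, without the power of \<open>h\<close>, divided by
\<open>taylor_weight m \<alpha>\<close>.\<close>

definition taylor_coeff :: "nat \<Rightarrow> nat ^ 3 \<Rightarrow> real ^ 3 \<Rightarrow> real" where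
  "taylor_coeff m \<alpha> y = 2 * (6 ^ m / fact m * (\<Prod>i\<in>UNIV. y $ i ^ (\<alpha> $ i)))"

definition taylor_mean :: "(nat \<Rightarrow> nat ^ 3 \<Rightarrow> real) \<Rightarrow> real" where
  "taylor_mean X = (\<Sum>m. \<Sum>\<alpha>\<in>multi_indices m. taylor_weight m \<alpha> * X m \<alpha>)"

lemma taylor_weight_nonneg: "taylor_weight m \<alpha> \<ge> 0"
  by (simp add: taylor_weight_def multinomial_nonneg)

lemma sum_taylor_weight: "(\<Sum>\<alpha>\<in>multi_indices m. taylor_weight m \<alpha>) = (1 / 2) ^ Suc m"
proof -
  have "(\<Sum>\<alpha>\<in>multi_indices m. multinomial m \<alpha>) = 3 ^ m"
    using multinomial_theorem[of "\<chi> i. 1" m] by simp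
  then show ?thesis
    unfolding taylor_weight_def sum_divide_distrib[symmetric] by (simp add: power_divide)
qed

lemma taylor_mean_summable:
  assumes "\<And>m \<alpha>. \<alpha> \<in> multi_indices m \<Longrightarrow> \<bar>X m \<alpha>\<bar> \<le> C"
  shows "summable (\<lambda>m. \<Sum>\<alpha>\<in>multi_indices m. taylor_weight m \<alpha> * X m \<alpha>)"
proof (rule summable_comparison_test')
  show "summable (\<lambda>m. C * (1 / 2) ^ Suc m :: real)"
    by (intro summable_mult summable_mult2) (simp add: summable_mult summable_geometric)
  fix m
  have "norm (\<Sum>\<alpha>\<in>multi_indices m. taylor_weight m \<alpha> * X m \<alpha>) \<le> (\<Sum>\<alpha>\<in>multi_indices m. taylor_weight m \<alpha> * C)"
    by (rule sum_norm_le) (simp add: abs_mult taylor_weight_nonneg mult_left_mono assms)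
  then show "norm (\<Sum>\<alpha>\<in>multi_indices m. taylor_weight m \<alpha> * X m \<alpha>) \<le> C * (1 / 2) ^ Suc m"
    unfolding sum_distrib_right[symmetric] sum_taylor_weight by (simp add: mult.commute)
qed

text \<open>Jensen's inequality, from the tangent of the exponential at the mean.\<close>

lemma exp_taylor_mean_le:
  assumes X: "\<And>m \<alpha>. \<alpha> \<in> multi_indices m \<Longrightarrow> \<bar>X m \<alpha>\<bar> \<le> C"
  shows "exp (taylor_mean X) \<le> taylor_mean (\<lambda>m \<alpha>. exp (X m \<alpha>))"
proof -
  define z where "z = taylor_mean X"
  have "(\<lambda>m. \<Sum>\<alpha>\<in>multi_indices m. taylor_weight m \<alpha> * X m \<alpha>) sums z"
    unfolding z_def taylor_mean_def using taylor_mean_summable[OF X] by (rule summable_sums)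
  \<comment> \<open>The mean of the tangent \<open>exp z * (1 + (X - z))\<close> is \<open>exp z\<close>.\<close>
  from sums_mult[OF sums_add[OF this sums_mult[OF power_half_series, of "1 - z"]], of "exp z"]
  have "(\<lambda>m. exp z * ((\<Sum>\<alpha>\<in>multi_indices m. taylor_weight m \<alpha> * X m \<alpha>) + (1 - z) * (1 / 2) ^ Suc m)) sums exp z"
    by simp
  then have *: "(\<lambda>m. \<Sum>\<alpha>\<in>multi_indices m. taylor_weight m \<alpha> * (exp z * (1 + (X m \<alpha> - z)))) sums exp z"
    unfolding sum_taylor_weight[symmetric] sum_distrib_left sum.distrib[symmetric]
    by (simp add: algebra_simps)
  have summ: "summable (\<lambda>m. \<Sum>\<alpha>\<in>multi_indices m. taylor_weight m \<alpha> * exp (X m \<alpha>))"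
    by (rule taylor_mean_summable[where C = "exp C"]) (use X in \<open>force simp: abs_le_iff\<close>)
  have "exp z \<le> taylor_mean (\<lambda>m \<alpha>. exp (X m \<alpha>))"
    unfolding taylor_mean_def
  proof (rule sums_le[OF _ * summable_sums[OF summ]])
    fix m
    have "exp z * (1 + (X m \<alpha> - z)) \<le> exp (X m \<alpha>)" for \<alpha>
      using mult_left_mono[OF exp_ge_add_one_self[of "X m \<alpha> - z"], of "exp z"]
      by (simp flip: exp_add)
    then show "(\<Sum>\<alpha>\<in>multi_indices m. taylor_weight m \<alpha> * (exp z * (1 + (X m \<alpha> - z))))
        \<le> (\<Sum>\<alpha>\<in>multi_indices m. taylor_weight m \<alpha> * exp (X m \<alpha>))"
      by (intro sum_mono mult_left_mono taylor_weight_nonneg)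
  qed
  then show ?thesis by (simp add: z_def)
qed

lemma power_over_fact_le_exp: "x ^ m / fact m \<le> exp x" if "x \<ge> 0" for x :: real
proof -
  have "(\<lambda>m. x ^ m / fact m) sums exp x"
    using exp_converges[of x] by (simp add: divide_inverse mult.commute)
  then have "(\<Sum>k\<in>{m}. x ^ k / fact k) \<le> exp x"
    using that sum_le_suminf[of "\<lambda>k. x ^ k / fact k" "{m}"] by (simp add: sums_iff)
  then show ?thesis by simp
qed

lemma abs_taylor_coeff_le:
  assumes "\<alpha> \<in> multi_indices m"
  shows "\<bar>taylor_coeff m \<alpha> y\<bar> \<le> 2 * exp (6 * norm y)"
proof -
  have "\<bar>\<Prod>i\<in>UNIV. y $ i ^ (\<alpha> $ i)\<bar> \<le> (\<Prod>i\<in>UNIV. norm y ^ (\<alpha> $ i))"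
    by (simp add: abs_prod power_abs) (intro prod_mono conjI power_mono component_le_norm_cart; simp)
  also have "\<dots> = norm y ^ m"
    using assms by (simp add: multi_indices_def flip: power_sum)
  finally have "\<bar>taylor_coeff m \<alpha> y\<bar> \<le> 2 * (6 ^ m / fact m * norm y ^ m)"
    by (simp add: taylor_coeff_def abs_mult mult_left_mono divide_right_mono)
  also have "\<dots> = 2 * ((6 * norm y) ^ m / fact m)" by (simp add: power_mult_distrib)
  also have "\<dots> \<le> 2 * exp (6 * norm y)" using power_over_fact_le_exp[of "6 * norm y" m] by simp
  finally show ?thesis .
qed

lemma exp_inner_taylor:
  fixes h y :: "real ^ 3"
  shows "(\<lambda>m. \<Sum>\<alpha>\<in>multi_indices m. taylor_weight m \<alpha> * ((\<Prod>i\<in>UNIV. h $ i ^ (\<alpha> $ i)) * taylor_coeff m \<alpha> y))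
    sums exp (\<Sum>i\<in>UNIV. h $ i * y $ i)"
proof -
  have "(\<Sum>i\<in>UNIV. h $ i * y $ i) ^ m / fact m = (\<Sum>\<alpha>\<in>multi_indices m. taylor_weight m \<alpha> *
      ((\<Prod>i\<in>UNIV. h $ i ^ (\<alpha> $ i)) * taylor_coeff m \<alpha> y))" for m
  proof -
    have "taylor_weight m \<alpha> * ((\<Prod>i\<in>UNIV. h $ i ^ (\<alpha> $ i)) * taylor_coeff m \<alpha> y) =
       multinomial m \<alpha> * (\<Prod>i\<in>UNIV. (h $ i * y $ i) ^ (\<alpha> $ i)) / fact m" for \<alpha>
    proof -
      have "(6 :: real) ^ m = 3 ^ m * 2 ^ m" by (simp flip: power_mult_distrib)
      then show ?thesis
        by (simp add: taylor_weight_def taylor_coeff_def power_mult_distrib prod.distrib)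
    qed
    then show ?thesis
      using multinomial_theorem[of "\<chi> i. h $ i * y $ i" m] by (simp flip: sum_divide_distrib)
  qed
  then show ?thesis
    using exp_converges[of "\<Sum>i\<in>UNIV. h $ i * y $ i"] by (simp add: divide_inverse mult.commute)
qed

text \<open>The point of the expansion: \<open>h\<close> enters each Taylor term only through a factor of modulus at
most 1, so the right-hand side bounds the supremum over all \<open>h\<close> in the cube at once. When the
\<open>c J\<close> are Gaussian, every term on the right is the modulus of a single Gaussian variable.\<close>

lemma abs_exp_sum_le_taylor_mean:
  fixes h :: "real ^ 3" and y :: "'j \<Rightarrow> real ^ 3"
  assumes h: "\<And>i. \<bar>h $ i\<bar> \<le> 1"
  shows "\<bar>\<Sum>J\<in>F. c J * exp (\<Sum>i\<in>UNIV. h $ i * y J $ i)\<bar>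
    \<le> taylor_mean (\<lambda>m \<alpha>. \<bar>\<Sum>J\<in>F. c J * taylor_coeff m \<alpha> (y J)\<bar>)"
proof -
  define H where "H \<alpha> = (\<Prod>i\<in>UNIV. h $ i ^ (\<alpha> $ i))" for \<alpha> :: "nat ^ 3"
  define Z where "Z m \<alpha> = (\<Sum>J\<in>F. c J * taylor_coeff m \<alpha> (y J))" for m \<alpha>
  have H: "\<bar>H \<alpha>\<bar> \<le> 1" for \<alpha>
    unfolding H_def abs_prod using h by (intro prod_le_1) (auto simp: power_abs power_le_one)
  have Z: "\<bar>Z m \<alpha>\<bar> \<le> (\<Sum>J\<in>F. \<bar>c J\<bar> * (2 * exp (6 * norm (y J))))" if "\<alpha> \<in> multi_indices m" for m \<alpha>
    unfolding Z_def real_norm_def[symmetric]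
    by (rule sum_norm_le) (auto simp: abs_mult intro!: mult_left_mono abs_taylor_coeff_le that)
  have "(\<lambda>m. \<Sum>J\<in>F. c J * (\<Sum>\<alpha>\<in>multi_indices m. taylor_weight m \<alpha> * (H \<alpha> * taylor_coeff m \<alpha> (y J))))
     sums (\<Sum>J\<in>F. c J * exp (\<Sum>i\<in>UNIV. h $ i * y J $ i))"
    unfolding H_def by (intro sums_sum sums_mult exp_inner_taylor)
  also have "(\<lambda>m. \<Sum>J\<in>F. c J * (\<Sum>\<alpha>\<in>multi_indices m. taylor_weight m \<alpha> * (H \<alpha> * taylor_coeff m \<alpha> (y J)))) =
      (\<lambda>m. \<Sum>\<alpha>\<in>multi_indices m. taylor_weight m \<alpha> * (H \<alpha> * Z m \<alpha>))"
    unfolding Z_def sum_distrib_left by (subst sum.swap) (simp add: mult_ac)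
  finally have *: "(\<lambda>m. \<Sum>\<alpha>\<in>multi_indices m. taylor_weight m \<alpha> * (H \<alpha> * Z m \<alpha>)) sums
      (\<Sum>J\<in>F. c J * exp (\<Sum>i\<in>UNIV. h $ i * y J $ i))" .
  have summ: "summable (\<lambda>m. \<Sum>\<alpha>\<in>multi_indices m. taylor_weight m \<alpha> * \<bar>Z m \<alpha>\<bar>)"
    using Z by (intro taylor_mean_summable) (simp only: abs_idempotent)
  have le: "norm (\<Sum>\<alpha>\<in>multi_indices m. taylor_weight m \<alpha> * (H \<alpha> * Z m \<alpha>)) \<le>
      (\<Sum>\<alpha>\<in>multi_indices m. taylor_weight m \<alpha> * \<bar>Z m \<alpha>\<bar>)" for m
    by (rule sum_norm_le)
      (auto simp: abs_mult taylor_weight_nonneg intro!: mult_left_mono mult_left_le_one_le H)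
  have "norm (\<Sum>m. \<Sum>\<alpha>\<in>multi_indices m. taylor_weight m \<alpha> * (H \<alpha> * Z m \<alpha>)) \<le>
      (\<Sum>m. \<Sum>\<alpha>\<in>multi_indices m. taylor_weight m \<alpha> * \<bar>Z m \<alpha>\<bar>)"
    by (rule norm_suminf_le[OF le summ])
  then show ?thesis using sums_unique[OF *] by (simp add: taylor_mean_def Z_def)
qed

section \<open>Gaussian tails for sums of suprema\<close>

text \<open>Completing the square turns the integrand into a multiple of the density of mean \<open>s\<close>.\<close>

lemma std_normal_mgf:
  assumes "distributed M lborel X std_normal_density"
  shows "(\<integral>\<^sup>+\<omega>. ennreal (exp (s * X \<omega>)) \<partial>M) = ennreal (exp (s\<^sup>2 / 2))"
proof -
  have "(\<integral>\<^sup>+\<omega>. ennreal (exp (s * X \<omega>)) \<partial>M) = (\<integral>\<^sup>+x. ennreal (std_normal_density x) * ennreal (exp (s * x)) \<partial>lborel)"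
    by (rule distributed_nn_integral[symmetric, OF assms]) simp
  also have "\<dots> = (\<integral>\<^sup>+x. ennreal (exp (s\<^sup>2 / 2)) * ennreal (normal_density s 1 x) \<partial>lborel)"
  proof (rule nn_integral_cong)
    fix x
    have "- x\<^sup>2 / 2 + s * x = s\<^sup>2 / 2 + - (x - s)\<^sup>2 / 2"
      by (simp add: power2_eq_square field_simps)
    then have "exp (- x\<^sup>2 / 2) * exp (s * x) = exp (s\<^sup>2 / 2) * exp (- (x - s)\<^sup>2 / 2)"
      by (simp only: exp_add[symmetric])
    then have "std_normal_density x * exp (s * x) = exp (s\<^sup>2 / 2) * normal_density s 1 x"
      by (simp add: normal_density_def std_normal_density_def)
    then show "ennreal (std_normal_density x) * ennreal (exp (s * x)) =
        ennreal (exp (s\<^sup>2 / 2)) * ennreal (normal_density s 1 x)"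
      by (simp flip: ennreal_mult)
  qed
  also have "\<dots> = ennreal (exp (s\<^sup>2 / 2))"
  proof -
    have "prob_space (density lborel (normal_density s 1))" by (rule prob_space_normal_density) simp
    then have "(\<integral>\<^sup>+x. ennreal (normal_density s 1 x) \<partial>lborel) = 1"
      using prob_space.emeasure_space_1[of "density lborel (normal_density s 1)"]
      by (simp add: emeasure_density)
    then show ?thesis by (simp add: nn_integral_cmult)
  qed
  finally show ?thesis .
qed

lemma gaussian_sum_mgf:
  assumes "prob_space M" "finite I" "iid_std_gaussian M I a"
  shows "(\<integral>\<^sup>+\<omega>. ennreal (exp (\<Sum>J\<in>I. c J * a J \<omega>)) \<partial>M) = ennreal (exp ((\<Sum>J\<in>I. (c J)\<^sup>2) / 2))"
proof -
  interpret prob_space M by fact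
  have ind: "indep_vars (\<lambda>_. borel) a I" and dist: "\<And>J. J \<in> I \<Longrightarrow> distributed M lborel (a J) std_normal_density"
    using assms by (auto simp: iid_std_gaussian_def)
  have "indep_vars (\<lambda>_. borel) (\<lambda>J \<omega>. ennreal (exp (c J * a J \<omega>))) I"
    by (rule indep_vars_compose2[OF ind]) simp
  then have "(\<integral>\<^sup>+\<omega>. (\<Prod>J\<in>I. ennreal (exp (c J * a J \<omega>))) \<partial>M) =
      (\<Prod>J\<in>I. \<integral>\<^sup>+\<omega>. ennreal (exp (c J * a J \<omega>)) \<partial>M)"
    using assms(2) by (intro indep_vars_nn_integral) auto
  also have "\<dots> = (\<Prod>J\<in>I. ennreal (exp ((c J)\<^sup>2 / 2)))"
    using std_normal_mgf[OF dist] by (intro prod.cong) auto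
  finally show ?thesis
    using assms(2) by (simp add: prod_ennreal exp_sum sum_divide_distrib)
qed

text \<open>A sum of moduli is the maximum of the \<open>2 ^ card T\<close> signed sums, and each signed sum is a single
Gaussian variable of variance at most \<open>V\<close>. The price \<open>2 ^ card T\<close> is affordable,
since the tails wanted are also exponential in \<open>card T\<close>.\<close>

lemma gaussian_abs_sum_mgf:
  assumes "prob_space M" "finite I" "iid_std_gaussian M I a" "finite T"
    and V: "(\<Sum>J\<in>I. (\<Sum>i\<in>T. \<bar>c i J\<bar>)\<^sup>2) \<le> V"
  shows "(\<integral>\<^sup>+\<omega>. ennreal (exp (l * (\<Sum>i\<in>T. \<bar>\<Sum>J\<in>I. c i J * a J \<omega>\<bar>))) \<partial>M)
    \<le> ennreal (2 ^ card T * exp (l\<^sup>2 * V / 2))"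
proof -
  have meas: "a J \<in> borel_measurable M" if "J \<in> I" for J
    using assms(3) that by (auto simp: iid_std_gaussian_def distributed_def)
  define Z where "Z i \<omega> = (\<Sum>J\<in>I. c i J * a J \<omega>)" for i \<omega>
  define S where "S = (T \<rightarrow>\<^sub>E {-1, 1 :: real})"
  have S: "finite S" "card S = 2 ^ card T"
    using assms(4) by (auto simp: S_def card_PiE finite_PiE numeral_2_eq_2)
  have pointwise: "exp (l * (\<Sum>i\<in>T. \<bar>Z i \<omega>\<bar>)) \<le> (\<Sum>\<epsilon>\<in>S. exp (\<Sum>J\<in>I. (l * (\<Sum>i\<in>T. \<epsilon> i * c i J)) * a J \<omega>))" for \<omega>
  proof -
    have "exp (l * (\<Sum>i\<in>T. \<bar>Z i \<omega>\<bar>)) = (\<Prod>i\<in>T. exp (l * \<bar>Z i \<omega>\<bar>))"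
      using assms(4) by (simp add: sum_distrib_left exp_sum)
    also have "\<dots> \<le> (\<Prod>i\<in>T. \<Sum>e\<in>{-1, 1}. exp (l * (e * Z i \<omega>)))"
      by (intro prod_mono) (auto simp: abs_if)
    also have "\<dots> = (\<Sum>\<epsilon>\<in>S. \<Prod>i\<in>T. exp (l * (\<epsilon> i * Z i \<omega>)))"
      unfolding S_def using assms(4) by (intro prod_sum_PiE) auto
    also have "\<dots> = (\<Sum>\<epsilon>\<in>S. exp (\<Sum>J\<in>I. (l * (\<Sum>i\<in>T. \<epsilon> i * c i J)) * a J \<omega>))"
    proof (intro sum.cong refl)
      fix \<epsilon>
      have "(\<Sum>i\<in>T. l * (\<epsilon> i * Z i \<omega>)) = (\<Sum>J\<in>I. (l * (\<Sum>i\<in>T. \<epsilon> i * c i J)) * a J \<omega>)"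
        unfolding Z_def sum_distrib_left sum_distrib_right by (subst sum.swap) (simp add: mult_ac)
      then show "(\<Prod>i\<in>T. exp (l * (\<epsilon> i * Z i \<omega>))) = exp (\<Sum>J\<in>I. (l * (\<Sum>i\<in>T. \<epsilon> i * c i J)) * a J \<omega>)"
        using assms(4) by (simp flip: exp_sum)
    qed
    finally show ?thesis .
  qed
  have "(\<integral>\<^sup>+\<omega>. ennreal (exp (l * (\<Sum>i\<in>T. \<bar>Z i \<omega>\<bar>))) \<partial>M) \<le>
     (\<integral>\<^sup>+\<omega>. (\<Sum>\<epsilon>\<in>S. ennreal (exp (\<Sum>J\<in>I. (l * (\<Sum>i\<in>T. \<epsilon> i * c i J)) * a J \<omega>))) \<partial>M)"
    by (intro nn_integral_mono) (simp add: sum_ennreal ennreal_leI pointwise)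
  also have "\<dots> = (\<Sum>\<epsilon>\<in>S. \<integral>\<^sup>+\<omega>. ennreal (exp (\<Sum>J\<in>I. (l * (\<Sum>i\<in>T. \<epsilon> i * c i J)) * a J \<omega>)) \<partial>M)"
    using meas by (intro nn_integral_sum) measurable
  also have "\<dots> = (\<Sum>\<epsilon>\<in>S. ennreal (exp ((\<Sum>J\<in>I. (l * (\<Sum>i\<in>T. \<epsilon> i * c i J))\<^sup>2) / 2)))"
    by (simp only: gaussian_sum_mgf[OF assms(1-3)])
  also have "\<dots> \<le> (\<Sum>\<epsilon>\<in>S. ennreal (exp (l\<^sup>2 * V / 2)))"
  proof (intro sum_mono ennreal_leI)
    fix \<epsilon> assume "\<epsilon> \<in> S"
    then have \<epsilon>: "\<bar>\<epsilon> i\<bar> = 1" if "i \<in> T" for i using that by (auto simp: S_def PiE_iff)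
    have "(\<Sum>J\<in>I. (l * (\<Sum>i\<in>T. \<epsilon> i * c i J))\<^sup>2) \<le> (\<Sum>J\<in>I. l\<^sup>2 * (\<Sum>i\<in>T. \<bar>c i J\<bar>)\<^sup>2)"
    proof (unfold power_mult_distrib, intro sum_mono mult_left_mono)
      fix J
      have "\<bar>\<Sum>i\<in>T. \<epsilon> i * c i J\<bar> \<le> (\<Sum>i\<in>T. \<bar>c i J\<bar>)"
        by (rule order_trans[OF sum_abs]) (simp add: abs_mult \<epsilon>)
      then show "(\<Sum>i\<in>T. \<epsilon> i * c i J)\<^sup>2 \<le> (\<Sum>i\<in>T. \<bar>c i J\<bar>)\<^sup>2"
        by (simp add: abs_le_square_iff[symmetric] sum_nonneg)
    qed auto
    also have "\<dots> \<le> l\<^sup>2 * V" using V by (simp add: mult_left_mono flip: sum_distrib_left)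
    finally show "exp ((\<Sum>J\<in>I. (l * (\<Sum>i\<in>T. \<epsilon> i * c i J))\<^sup>2) / 2) \<le> exp (l\<^sup>2 * V / 2)" by simp
  qed
  also have "\<dots> = ennreal (2 ^ card T * exp (l\<^sup>2 * V / 2))"
    using S by (simp add: ennreal_mult flip: ennreal_power)
  finally show ?thesis unfolding Z_def .
qed

lemma taylor_mean_add_scaled:
  assumes "finite T" and "\<And>i m \<alpha>. i \<in> T \<Longrightarrow> \<alpha> \<in> multi_indices m \<Longrightarrow> \<bar>X i m \<alpha>\<bar> \<le> C i"
  shows "taylor_mean (\<lambda>m \<alpha>. l * (\<Sum>i\<in>T. X i m \<alpha>)) = l * (\<Sum>i\<in>T. taylor_mean (X i))"
proof -
  have "(\<lambda>m. l * (\<Sum>i\<in>T. \<Sum>\<alpha>\<in>multi_indices m. taylor_weight m \<alpha> * X i m \<alpha>)) sums (l * (\<Sum>i\<in>T. taylor_mean (X i)))"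
    unfolding taylor_mean_def
    using assms(2) by (intro sums_mult sums_sum summable_sums taylor_mean_summable) blast
  moreover have "l * (\<Sum>i\<in>T. \<Sum>\<alpha>\<in>multi_indices m. taylor_weight m \<alpha> * X i m \<alpha>) =
      (\<Sum>\<alpha>\<in>multi_indices m. taylor_weight m \<alpha> * (l * (\<Sum>i\<in>T. X i m \<alpha>)))" for m
    unfolding sum_distrib_left by (subst sum.swap) (simp add: mult_ac)
  ultimately show ?thesis by (simp add: taylor_mean_def sums_iff)
qed

text \<open>If every supremum exceeds \<open>s\<close>, then the sum of the suprema exceeds \<open>card T * s\<close>. Its
exponential is bounded pointwise by the Taylor mean of exponentials of sums of Gaussian moduli, whose
expectation is controlled uniformly in the multi-index, and Markov's inequality applies. The
conclusion speaks of a measurable event containing the one of interest, so that measurability of the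
suprema does not arise.\<close>

lemma exponential_sum_sup_tail:
  fixes y :: "'i \<Rightarrow> 'j \<Rightarrow> real ^ 3" and s :: real
  assumes M: "prob_space M" and I: "finite I" "iid_std_gaussian M I a" and T: "finite T"
    and V: "(\<Sum>J\<in>I. (\<Sum>i\<in>T. \<bar>c i J\<bar> * (2 * exp (6 * norm (y i J))))\<^sup>2) \<le> V" "V > 0" and s: "s > 0"
  shows "\<exists>E\<in>sets M. {\<omega> \<in> space M. \<forall>i\<in>T. \<exists>h :: real ^ 3. (\<forall>k. \<bar>h $ k\<bar> \<le> 1) \<and>
            \<bar>\<Sum>J\<in>I. c i J * exp (\<Sum>k\<in>UNIV. h $ k * y i J $ k) * a J \<omega>\<bar> > s} \<subseteq> E \<and>
     measure M E \<le> 2 ^ card T * exp (- ((card T * s)\<^sup>2 / (2 * V)))"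
proof -
  interpret prob_space M by fact
  have meas [measurable]: "a J \<in> borel_measurable M" if "J \<in> I" for J
    using I that by (auto simp: iid_std_gaussian_def distributed_def)
  define X where "X \<omega> i m \<alpha> = \<bar>\<Sum>J\<in>I. (c i J * taylor_coeff m \<alpha> (y i J)) * a J \<omega>\<bar>" for \<omega> i m \<alpha>
  \<comment> \<open>Minimises the Chernoff exponent \<open>l\<^sup>2 * V / 2 - l * (card T * s)\<close>.\<close>
  define l where "l = card T * s / V"
  have l: "l \<ge> 0" using s V by (simp add: l_def)
  define R where "R \<omega> = (\<Sum>m. \<Sum>\<alpha>\<in>multi_indices m. ennreal (taylor_weight m \<alpha>) * ennreal (exp (l * (\<Sum>i\<in>T. X \<omega> i m \<alpha>))))" for \<omega>
  have Xb: "\<bar>X \<omega> i m \<alpha>\<bar> \<le> (\<Sum>J\<in>I. \<bar>c i J\<bar> * (2 * exp (6 * norm (y i J))) * \<bar>a J \<omega>\<bar>)"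
    if "\<alpha> \<in> multi_indices m" for \<omega> i m \<alpha>
    unfolding X_def abs_idempotent
    by (rule order_trans[OF sum_abs])
      (auto simp: abs_mult intro!: sum_mono mult_right_mono mult_left_mono abs_taylor_coeff_le that)
  have R_meas [measurable]: "R \<in> borel_measurable M"
    unfolding R_def X_def using meas by measurable
  have "integral\<^sup>N M R = (\<Sum>m. \<Sum>\<alpha>\<in>multi_indices m. ennreal (taylor_weight m \<alpha>) * (\<integral>\<^sup>+\<omega>. ennreal (exp (l * (\<Sum>i\<in>T. X \<omega> i m \<alpha>))) \<partial>M))"
    unfolding R_def X_def using meas
    by (subst nn_integral_suminf, measurable, subst nn_integral_sum, measurable, subst nn_integral_cmult, measurable)
  also have "\<dots> \<le> (\<Sum>m. \<Sum>\<alpha>\<in>multi_indices m. ennreal (taylor_weight m \<alpha>) * ennreal (2 ^ card T * exp (l\<^sup>2 * V / 2)))"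
  proof (intro suminf_le sum_mono mult_left_mono)
    fix m \<alpha> assume \<alpha>: "\<alpha> \<in> multi_indices m"
    have "(\<Sum>J\<in>I. (\<Sum>i\<in>T. \<bar>c i J * taylor_coeff m \<alpha> (y i J)\<bar>)\<^sup>2) \<le>
        (\<Sum>J\<in>I. (\<Sum>i\<in>T. \<bar>c i J\<bar> * (2 * exp (6 * norm (y i J))))\<^sup>2)"
      by (intro sum_mono power_mono sum_nonneg)
         (auto simp: abs_mult intro!: mult_left_mono abs_taylor_coeff_le \<alpha>)
    also note V(1)
    finally show "(\<integral>\<^sup>+\<omega>. ennreal (exp (l * (\<Sum>i\<in>T. X \<omega> i m \<alpha>))) \<partial>M) \<le> ennreal (2 ^ card T * exp (l\<^sup>2 * V / 2))"
      unfolding X_def by (rule gaussian_abs_sum_mgf[OF M I T])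
  qed auto
  also have "\<dots> = (\<Sum>m. ennreal ((1 / 2) ^ Suc m)) * ennreal (2 ^ card T * exp (l\<^sup>2 * V / 2))"
  proof -
    have "(\<Sum>\<alpha>\<in>multi_indices m. ennreal (taylor_weight m \<alpha>)) = ennreal ((1 / 2) ^ Suc m)" for m
      unfolding sum_taylor_weight[symmetric] by (intro sum_ennreal taylor_weight_nonneg)
    then show ?thesis unfolding sum_distrib_right[symmetric] by (simp only: ennreal_suminf_multc)
  qed
  also have "(\<Sum>m. ennreal ((1 / 2) ^ Suc m)) = 1"
  proof -
    have "(\<Sum>m. ennreal ((1 / 2) ^ Suc m)) = ennreal 1"
      by (rule suminf_ennreal_eq[OF _ power_half_series]) (rule zero_le_power, simp)
    then show ?thesis by (simp only: ennreal_1)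
  qed
  finally have R_int: "integral\<^sup>N M R \<le> ennreal (2 ^ card T * exp (l\<^sup>2 * V / 2))" by simp
  define E where "E = {\<omega> \<in> space M. 1 \<le> ennreal (exp (- (l * (card T * s)))) * R \<omega>}"
  have E: "E \<in> sets M" unfolding E_def by measurable
  have "emeasure M E \<le> ennreal (exp (- (l * (card T * s)))) * integral\<^sup>N M R"
    unfolding E_def using nn_integral_Markov_inequality[of R "space M" M "ennreal (exp (- (l * (card T * s))))"]
    by (simp cong: nn_integral_cong)
  also have "\<dots> \<le> ennreal (exp (- (l * (card T * s)))) * ennreal (2 ^ card T * exp (l\<^sup>2 * V / 2))"
    by (intro mult_left_mono R_int) auto
  also have "\<dots> = ennreal (2 ^ card T * exp (- ((card T * s)\<^sup>2 / (2 * V))))"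
  proof -
    have "- (l * (card T * s)) + l\<^sup>2 * V / 2 = - ((card T * s)\<^sup>2 / (2 * V))"
      using V(2) by (simp add: l_def power2_eq_square field_simps)
    then show ?thesis by (simp add: mult.left_commute flip: ennreal_mult exp_add)
  qed
  finally have PE: "measure M E \<le> 2 ^ card T * exp (- ((card T * s)\<^sup>2 / (2 * V)))"
    by (simp add: emeasure_eq_measure)
  have "\<omega> \<in> E" if \<omega>: "\<omega> \<in> space M" and ex: "\<forall>i\<in>T. \<exists>h :: real ^ 3. (\<forall>k. \<bar>h $ k\<bar> \<le> 1) \<and>
            \<bar>\<Sum>J\<in>I. c i J * exp (\<Sum>k\<in>UNIV. h $ k * y i J $ k) * a J \<omega>\<bar> > s" for \<omega>
  proof -
    have "s \<le> taylor_mean (X \<omega> i)" if i: "i \<in> T" for i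
    proof -
      from ex i obtain h :: "real ^ 3" where h: "\<And>k. \<bar>h $ k\<bar> \<le> 1" and
        gt: "\<bar>\<Sum>J\<in>I. c i J * exp (\<Sum>k\<in>UNIV. h $ k * y i J $ k) * a J \<omega>\<bar> > s" by blast
      have "\<bar>\<Sum>J\<in>I. (c i J * a J \<omega>) * exp (\<Sum>k\<in>UNIV. h $ k * y i J $ k)\<bar> \<le> taylor_mean (X \<omega> i)"
        using abs_exp_sum_le_taylor_mean[OF h, where F = I and c = "\<lambda>J. c i J * a J \<omega>" and y = "y i"]
        by (simp add: X_def[abs_def] mult_ac)
      with gt show ?thesis by (simp add: mult_ac)
    qed
    then have "l * (card T * s) \<le> l * (\<Sum>i\<in>T. taylor_mean (X \<omega> i))"
      using l sum_bounded_below[of T s "\<lambda>i. taylor_mean (X \<omega> i)"] by (intro mult_left_mono) auto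
    also have "\<dots> = taylor_mean (\<lambda>m \<alpha>. l * (\<Sum>i\<in>T. X \<omega> i m \<alpha>))"
      using T Xb by (rule taylor_mean_add_scaled[symmetric])
    finally have "exp (l * (card T * s)) \<le> exp (taylor_mean (\<lambda>m \<alpha>. l * (\<Sum>i\<in>T. X \<omega> i m \<alpha>)))" by simp
    moreover have bd: "\<bar>l * (\<Sum>i\<in>T. X \<omega> i m \<alpha>)\<bar> \<le> l * (\<Sum>i\<in>T. \<Sum>J\<in>I. \<bar>c i J\<bar> * (2 * exp (6 * norm (y i J))) * \<bar>a J \<omega>\<bar>)"
      if "\<alpha> \<in> multi_indices m" for m \<alpha>
      unfolding abs_mult using l Xb[OF that]
      by (auto intro!: mult_mono order_trans[OF sum_abs] sum_mono)
    moreover have "exp (taylor_mean (\<lambda>m \<alpha>. l * (\<Sum>i\<in>T. X \<omega> i m \<alpha>))) \<le> taylor_mean (\<lambda>m \<alpha>. exp (l * (\<Sum>i\<in>T. X \<omega> i m \<alpha>)))"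
      by (rule exp_taylor_mean_le[OF bd])
    ultimately have "ennreal (exp (l * (card T * s))) \<le> ennreal (taylor_mean (\<lambda>m \<alpha>. exp (l * (\<Sum>i\<in>T. X \<omega> i m \<alpha>))))"
      by (intro ennreal_leI) linarith
    also have "\<dots> = R \<omega>"
    proof -
      have "summable (\<lambda>m. \<Sum>\<alpha>\<in>multi_indices m. taylor_weight m \<alpha> * exp (l * (\<Sum>i\<in>T. X \<omega> i m \<alpha>)))"
        by (rule taylor_mean_summable, subst abs_of_nonneg, simp, subst exp_le_cancel_iff,
            rule order_trans[OF abs_ge_self bd])
      then have "ennreal (taylor_mean (\<lambda>m \<alpha>. exp (l * (\<Sum>i\<in>T. X \<omega> i m \<alpha>)))) =
          (\<Sum>m. ennreal (\<Sum>\<alpha>\<in>multi_indices m. taylor_weight m \<alpha> * exp (l * (\<Sum>i\<in>T. X \<omega> i m \<alpha>))))"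
        unfolding taylor_mean_def
        by (intro suminf_ennreal2[symmetric] sum_nonneg mult_nonneg_nonneg taylor_weight_nonneg) auto
      then show ?thesis
        by (simp add: R_def taylor_weight_nonneg flip: sum_ennreal ennreal_mult)
    qed
    finally have "ennreal (exp (- (l * (card T * s)))) * ennreal (exp (l * (card T * s))) \<le> ennreal (exp (- (l * (card T * s)))) * R \<omega>"
      by (rule mult_left_mono) simp
    then show ?thesis using \<omega> by (simp add: E_def flip: ennreal_mult exp_add)
  qed
  with E PE show ?thesis by blast
qed

section \<open>Geometry of the sphere and of the cells\<close>

lemma norm_diff_sphere:
  assumes "x \<in> S2" "y \<in> S2"
  shows "norm (x - y) = 2 * sin (sphere_dist x y / 2)" "sphere_dist x y \<in> {0..pi}"
proof -
  define d where "d = sphere_dist x y"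
  have "\<bar>x \<bullet> y\<bar> \<le> 1" using Cauchy_Schwarz_ineq2[of x y] assms by simp
  then have d: "cos d = x \<bullet> y" "0 \<le> d" "d \<le> pi"
    by (auto simp: d_def sphere_dist_def abs_le_iff intro: arccos_lbound arccos_ubound)
  have "(norm (x - y))\<^sup>2 = 2 - 2 * (x \<bullet> y)"
    using assms by (simp add: power2_norm_eq_inner inner_diff_left inner_diff_right inner_commute norm_eq_1)
  also have "\<dots> = (2 * sin (d / 2))\<^sup>2" using cos_double_sin[of "d / 2"] d by (simp add: power_mult_distrib)
  finally have "(norm (x - y))\<^sup>2 = (2 * sin (d / 2))\<^sup>2" .
  moreover have "0 \<le> 2 * sin (d / 2)" using d by (simp add: sin_ge_zero)
  ultimately show "norm (x - y) = 2 * sin (sphere_dist x y / 2)"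
    unfolding d_def[symmetric] by (rule power2_eq_imp_eq[OF _ norm_ge_zero])
  show "sphere_dist x y \<in> {0..pi}" using d d_def by auto
qed

lemma norm_diff_le_sphere_dist: "x \<in> S2 \<Longrightarrow> y \<in> S2 \<Longrightarrow> norm (x - y) \<le> sphere_dist x y"
  using norm_diff_sphere[of x y] sin_x_le_x[of "sphere_dist x y / 2"] by auto

text \<open>The cubic Taylor bound for the sine loses only a constant, as half the distance is at most
\<open>pi / 2\<close>, hence below 2.\<close>

lemma sphere_dist_le_norm_diff:
  assumes "x \<in> S2" "y \<in> S2"
  shows "sphere_dist x y \<le> 3 * norm (x - y)"
proof -
  define z where "z = sphere_dist x y / 2"
  have z: "0 \<le> z" "z \<le> 2" using norm_diff_sphere(2)[OF assms] pi_less_4 by (auto simp: z_def)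
  have "\<bar>sin z - z\<bar> \<le> z ^ 3 / 6"
  proof -
    have "(\<Sum>m<3. sin_coeff m * z ^ m) = z" by (simp add: sin_coeff_def numeral_3_eq_3)
    moreover have "inverse (fact 3) * \<bar>z\<bar> ^ 3 = z ^ 3 / 6" using z by (simp add: fact_numeral)
    ultimately show ?thesis using Maclaurin_sin_bound[of z 3] by simp
  qed
  moreover have "z ^ 3 \<le> z * 4"
  proof -
    have "z ^ 2 \<le> 2 ^ 2" using z by (intro power_mono)
    then show ?thesis using mult_left_mono[of "z ^ 2" 4 z] z by (simp add: power3_eq_cube power2_eq_square)
  qed
  ultimately have "z \<le> 3 * sin z" by linarith
  then show ?thesis using norm_diff_sphere(1)[OF assms] by (simp add: z_def)
qed

lemma compact_orthant_coordinates_bounded_below: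
  assumes "compact U" "U \<subseteq> orthant"
  shows "\<exists>\<delta>>0. \<forall>x\<in>U. \<forall>i. x $ i \<ge> \<delta>"
proof (cases "U = {}")
  case True
  then show ?thesis by (intro exI[of _ 1]) auto
next
  case False
  have "\<exists>x\<in>U. \<forall>y\<in>U. x $ i \<le> y $ i" for i
    using assms(1) False by (rule continuous_attains_inf) (intro continuous_intros)
  then obtain m where m: "\<And>i. m i \<in> U" "\<And>i y. y \<in> U \<Longrightarrow> m i $ i \<le> y $ i" by metis
  define \<delta> where "\<delta> = Min (range (\<lambda>i. m i $ i))"
  have "\<delta> \<in> range (\<lambda>i. m i $ i)" unfolding \<delta>_def by (rule Min_in) auto
  then have "\<delta> > 0" using m(1) assms(2) by (auto simp: orthant_def)
  moreover have "\<delta> \<le> y $ i" if "y \<in> U" for y i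
  proof -
    have "\<delta> \<le> m i $ i" unfolding \<delta>_def by (rule Min_le) auto
    then show ?thesis using m(2)[OF that, of i] by linarith
  qed
  ultimately show ?thesis by blast
qed

text \<open>This is where the orthant enters: squaring coordinates is expanding with factor \<open>2 * \<delta>\<close>
only on coordinates bounded below by \<open>\<delta>\<close>. Antipodal points, for instance, have the
same centre.\<close>

lemma centre_separation:
  assumes "\<delta> > 0" "\<And>i. x $ i \<ge> \<delta>" "\<And>i. y $ i \<ge> \<delta>"
  shows "norm (centre n x - centre n y) \<ge> 2 * \<delta> * sqrt n * norm (x - y)"
proof -
  have "norm ((2 * \<delta> * sqrt n) *\<^sub>R (x - y)) \<le> norm (centre n x - centre n y)"
  proof (rule norm_le_componentwise_cart)
    fix i
    have eq: "(centre n x - centre n y) $ i = sqrt n * ((x $ i + y $ i) * (x $ i - y $ i))"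
      by (simp add: centre_def power2_eq_square algebra_simps)
    have "2 * \<delta> * \<bar>x $ i - y $ i\<bar> \<le> \<bar>x $ i + y $ i\<bar> * \<bar>x $ i - y $ i\<bar>"
      using assms(1) assms(2)[of i] assms(3)[of i] by (intro mult_right_mono) auto
    then have "sqrt n * (2 * \<delta> * \<bar>x $ i - y $ i\<bar>) \<le> sqrt n * (\<bar>x $ i + y $ i\<bar> * \<bar>x $ i - y $ i\<bar>)"
      by (intro mult_left_mono) auto
    then show "norm (((2 * \<delta> * sqrt n) *\<^sub>R (x - y)) $ i) \<le> norm ((centre n x - centre n y) $ i)"
      unfolding eq using assms(1)
      by (simp add: abs_mult mult_ac del: right_diff_distrib_numeral left_diff_distrib_numeral)
  qed
  then show ?thesis using assms(1) by (simp add: abs_mult)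
qed

text \<open>Displacement in logarithmic coordinates, in which monomials become exponentials, on the scale at
which the field varies.\<close>

definition log_shift :: "nat \<Rightarrow> real ^ 3 \<Rightarrow> real ^ 3 \<Rightarrow> real ^ 3" where
  "log_shift n z x = (\<chi> k. sqrt (real n) * ln (x $ k / z $ k))"

text \<open>Moving from \<open>z\<close> to \<open>x\<close> multiplies the basis function by an exponential of the
deviation, up to a factor common to all \<open>J\<close> of degree \<open>n\<close>.\<close>

lemma kostlan_basis_shift:
  assumes "n \<ge> 1" "x \<in> orthant" "z \<in> orthant"
  shows "kostlan_basis n J x = exp (\<Sum>k\<in>UNIV. log_shift n z x $ k * centre n z $ k) *
    (kostlan_basis n J z * exp (\<Sum>k\<in>UNIV. log_shift n z x $ k * deviation n J z $ k))"
proof -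
  define h where "h = log_shift n z x"
  have pos: "x $ k > 0" "z $ k > 0" for k using assms by (auto simp: orthant_def)
  have "x $ k ^ (J $ k) = z $ k ^ (J $ k) * exp (h $ k * centre n z $ k + h $ k * deviation n J z $ k)" for k
  proof -
    have "h $ k * centre n z $ k + h $ k * deviation n J z $ k = h $ k * (real (J $ k) / sqrt n)"
      by (simp add: deviation_eq algebra_simps)
    also have "\<dots> = real (J $ k) * ln (x $ k / z $ k)"
      using assms(1) by (simp add: h_def log_shift_def)
    also have "exp \<dots> = (x $ k / z $ k) ^ (J $ k)"
      using pos by (simp add: exp_of_nat_mult)
    finally show ?thesis using pos[of k] by (simp add: power_divide)
  qed
  then have "(\<Prod>k\<in>UNIV. x $ k ^ (J $ k)) = (\<Prod>k\<in>UNIV. z $ k ^ (J $ k)) *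
      exp (\<Sum>k\<in>UNIV. h $ k * centre n z $ k + h $ k * deviation n J z $ k)"
    by (simp add: prod.distrib exp_sum)
  then show ?thesis
    unfolding kostlan_basis_def h_def[symmetric] sum.distrib exp_add by (simp add: mult_ac)
qed

text \<open>Hence the common factor in the shift formula is at most 1. This is Gibbs' inequality for the
probability vectors \<open>x\<^sub>k\<^sup>2\<close> and \<open>z\<^sub>k\<^sup>2\<close>, following from
\<open>ln y \<le> y - 1\<close>.\<close>

lemma log_shift_centre_nonpos:
  assumes "x \<in> S2 \<inter> orthant" "z \<in> S2 \<inter> orthant"
  shows "(\<Sum>k\<in>UNIV. log_shift n z x $ k * centre n z $ k) \<le> 0"
proof -
  have pos: "x $ k > 0" "z $ k > 0" for k using assms by (auto simp: orthant_def)
  have "log_shift n z x $ k * centre n z $ k \<le> n / 2 * ((x $ k)\<^sup>2 - (z $ k)\<^sup>2)" for k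
  proof -
    have "2 * ln (x $ k / z $ k) = ln ((x $ k / z $ k)\<^sup>2)"
      using pos by (simp add: ln_realpow)
    also have "\<dots> \<le> (x $ k / z $ k)\<^sup>2 - 1" using pos[of k] by (intro ln_le_minus_one) simp
    finally have "2 * ln (x $ k / z $ k) * (z $ k)\<^sup>2 \<le> ((x $ k / z $ k)\<^sup>2 - 1) * (z $ k)\<^sup>2"
      by (rule mult_right_mono) simp
    also have "\<dots> = (x $ k)\<^sup>2 - (z $ k)\<^sup>2" using pos[of k] by (simp add: power_divide field_simps)
    finally have "n / 2 * (2 * ln (x $ k / z $ k) * (z $ k)\<^sup>2) \<le> n / 2 * ((x $ k)\<^sup>2 - (z $ k)\<^sup>2)"
      by (intro mult_left_mono) auto
    moreover have "log_shift n z x $ k * centre n z $ k = (sqrt n * sqrt n) * (ln (x $ k / z $ k) * (z $ k)\<^sup>2)"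
      unfolding log_shift_def centre_def by (simp only: vec_lambda_beta mult_ac)
    ultimately show ?thesis by simp
  qed
  then have "(\<Sum>k\<in>UNIV. log_shift n z x $ k * centre n z $ k) \<le> (\<Sum>k\<in>UNIV. n / 2 * ((x $ k)\<^sup>2 - (z $ k)\<^sup>2))"
    by (rule sum_mono)
  also have "\<dots> = 0"
    unfolding sum_distrib_left[symmetric] sum_subtractf using assms by (simp only: Int_iff sum_squares_sphere) simp
  finally show ?thesis .
qed

lemma abs_ln_diff_le:
  fixes a b :: real
  assumes "\<delta> > 0" "a \<ge> \<delta>" "b \<ge> \<delta>"
  shows "\<bar>ln a - ln b\<bar> \<le> \<bar>a - b\<bar> / \<delta>"
proof -
  have *: "ln a - ln b \<le> \<bar>a - b\<bar> / \<delta>" if "a \<ge> \<delta>" "b \<ge> \<delta>" for a b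
  proof -
    have "ln a - ln b = ln (a / b)" using that assms(1) by (simp add: ln_div)
    also have "\<dots> \<le> a / b - 1" using that assms(1) by (intro ln_le_minus_one) simp
    also have "\<dots> = (a - b) / b" using that assms(1) by (simp add: field_simps)
    also have "\<dots> \<le> \<bar>a - b\<bar> / b" using that assms(1) by (intro divide_right_mono) auto
    also have "\<dots> \<le> \<bar>a - b\<bar> / \<delta>" using that assms(1) by (intro divide_left_mono) auto
    finally show ?thesis .
  qed
  show ?thesis using *[of a b] *[of b a] assms by (simp add: abs_le_iff abs_minus_commute)
qed

text \<open>One representative in each occupied cell of the unit grid in the coordinates
\<open>sqrt n * ln x\<^sub>k\<close>. These coordinates are Lipschitz with constant
\<open>sqrt n / \<delta>\<close>, on points whose coordinates are at least \<open>\<delta>\<close>, so the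
number of cells that \<open>U\<close> meets is polynomial in \<open>u * sqrt n\<close>.\<close>

lemma log_shift_net:
  assumes \<delta>: "\<delta> > 0" and U: "U \<subseteq> S2" "\<And>x i. x \<in> U \<Longrightarrow> x $ i \<ge> \<delta>"
    and cap: "c \<in> S2" "U \<subseteq> sphere_cap u c" and u: "u * sqrt n \<ge> 1"
  shows "\<exists>N\<subseteq>U. finite N \<and> real (card N) \<le> ((4 / \<delta> + 2) * (u * sqrt n)) ^ 3 \<and>
           (\<forall>x\<in>U. \<exists>z\<in>N. \<forall>k. \<bar>log_shift n z x $ k\<bar> \<le> 1)"
proof (cases "U = {}")
  case True
  then show ?thesis using \<delta> u by (intro exI[of _ "{}"]) auto
next
  case False
  then obtain y where y: "y \<in> U" by blast
  define W where "W = 2 * (u * sqrt n) / \<delta>"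
  define l where "l x k = sqrt n * ln (x $ k)" for x :: "real ^ 3" and k
  define L where "L x = (\<lfloor>l x 1\<rfloor>, \<lfloor>l x 2\<rfloor>, \<lfloor>l x 3\<rfloor>)" for x
  define B where "B k = {\<lfloor>l y k - W\<rfloor>..\<lfloor>l y k + W\<rfloor>}" for k
  have lW: "\<bar>l x k - l y k\<bar> \<le> W" if x: "x \<in> U" for x k
  proof -
    have "\<bar>x $ k - y $ k\<bar> \<le> norm (x - y)" using component_le_norm_cart[of "x - y" k] by simp
    also have "\<dots> \<le> norm (c - x) + norm (c - y)" using norm_triangle_ineq4[of "c - y" "c - x"] by simp
    also have "\<dots> \<le> u + u"
      using x y U(1) cap norm_diff_le_sphere_dist[of c x] norm_diff_le_sphere_dist[of c y]
      by (intro add_mono) (auto simp: sphere_cap_def intro: order_trans)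
    finally have "\<bar>x $ k - y $ k\<bar> / \<delta> \<le> 2 * u / \<delta>" using \<delta> by (intro divide_right_mono) auto
    then have "\<bar>ln (x $ k) - ln (y $ k)\<bar> \<le> 2 * u / \<delta>"
      using abs_ln_diff_le[OF \<delta> U(2)[OF x] U(2)[OF y], of k k] by linarith
    then have "sqrt n * \<bar>ln (x $ k) - ln (y $ k)\<bar> \<le> sqrt n * (2 * u / \<delta>)" by (intro mult_left_mono) auto
    then show ?thesis by (simp add: l_def W_def mult_ac abs_mult flip: right_diff_distrib)
  qed
  have LB: "L ` U \<subseteq> B 1 \<times> B 2 \<times> B 3"
  proof -
    have "\<lfloor>l x k\<rfloor> \<in> B k" if "x \<in> U" for x k
      using lW[OF that, of k] unfolding B_def by (auto intro!: floor_mono)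
    then show ?thesis by (auto simp: L_def)
  qed
  have cB: "real (card (B k)) \<le> (4 / \<delta> + 2) * (u * sqrt n)" for k
  proof -
    have "W \<ge> 0" using u \<delta> by (simp add: W_def)
    then have "real (card (B k)) \<le> 2 * W + 2" unfolding B_def by simp linarith
    also have "\<dots> \<le> (4 / \<delta> + 2) * (u * sqrt n)" using u by (simp add: W_def distrib_right)
    finally show ?thesis .
  qed
  have finB: "finite (L ` U)" using LB by (rule finite_subset) (auto simp: B_def)
  define rep where "rep v = (SOME x. x \<in> U \<and> L x = v)" for v
  have rep: "rep (L x) \<in> U" "L (rep (L x)) = L x" if "x \<in> U" for x
    using someI[of "\<lambda>z. z \<in> U \<and> L z = L x" x] that by (auto simp: rep_def)
  define N where "N = rep ` L ` U"
  have "real (card N) \<le> real (card (L ` U))" unfolding N_def using finB by (simp add: card_image_le)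
  also have "\<dots> \<le> real (card (B 1 \<times> B 2 \<times> B 3))"
    using LB by (intro of_nat_mono card_mono) (auto simp: B_def)
  also have "\<dots> = real (card (B 1)) * real (card (B 2)) * real (card (B 3))" by (simp add: card_cartesian_product)
  also have "\<dots> \<le> ((4 / \<delta> + 2) * (u * sqrt n)) * ((4 / \<delta> + 2) * (u * sqrt n)) * ((4 / \<delta> + 2) * (u * sqrt n))"
    using \<delta> u by (intro mult_mono cB) auto
  finally have cN: "real (card N) \<le> ((4 / \<delta> + 2) * (u * sqrt n)) ^ 3" by (simp add: power3_eq_cube)
  have "\<exists>z\<in>N. \<forall>k. \<bar>log_shift n z x $ k\<bar> \<le> 1" if x: "x \<in> U" for x
  proof (intro bexI allI)
    define z where "z = rep (L x)"
    fix k
    have "\<lfloor>l z k\<rfloor> = \<lfloor>l x k\<rfloor>" using rep(2)[OF x] exhaust_3[of k] by (auto simp: z_def L_def)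
    then have "\<bar>l x k - l z k\<bar> \<le> 1" by linarith
    moreover have "x $ k > 0" "z $ k > 0" using U(2)[OF x, of k] U(2)[OF rep(1)[OF x], of k] \<delta> by (auto simp: z_def)
    ultimately show "\<bar>log_shift n (rep (L x)) x $ k\<bar> \<le> 1"
      by (simp add: z_def[symmetric] log_shift_def l_def ln_div right_diff_distrib)
  qed (use x in \<open>auto simp: N_def\<close>)
  moreover have "N \<subseteq> U" using rep(1) by (auto simp: N_def)
  ultimately show ?thesis using cN finB by (intro exI[of _ N]) (auto simp: N_def)
qed

section \<open>Tails of the truncation errors\<close>

definition near_indices :: "nat \<Rightarrow> real \<Rightarrow> (real ^ 3) set \<Rightarrow> (nat ^ 3) set" where
  "near_indices n \<rho> U = {J \<in> multi_indices n. \<exists>x\<in>U. norm (deviation n J x) \<le> \<rho>}"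

definition partial_kostlan :: "nat \<Rightarrow> (nat ^ 3) set \<Rightarrow> (nat ^ 3 \<Rightarrow> 'w \<Rightarrow> real) \<Rightarrow> 'w \<Rightarrow> real ^ 3 \<Rightarrow> real" where
  "partial_kostlan n F a \<omega> x = (\<Sum>J\<in>F. kostlan_basis n J x * a J \<omega>)"

text \<open>Choosing one cell for each \<open>i\<close> and taking a union bound over all choices costs a factor
\<open>\<nu> ^ card T\<close>, again of the same form as the tail. For a fixed choice the suprema over the
cells are bounded by the Gaussian tail estimate, with the variance from the almost orthogonality.\<close>

lemma truncation_errors_tail:
  fixes U :: "nat \<Rightarrow> (real ^ 3) set" and \<delta> :: real
  assumes M: "prob_space M" and iid: "iid_std_gaussian M (multi_indices n) a" and n: "n \<ge> 1"
    and \<delta>: "\<delta> > 0" and u: "u * sqrt n \<ge> 1" and T: "finite T" "T \<noteq> {}"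
    and U: "\<And>i. i \<in> T \<Longrightarrow> U i \<subseteq> S2" "\<And>i x k. i \<in> T \<Longrightarrow> x \<in> U i \<Longrightarrow> x $ k \<ge> \<delta>"
      "\<And>i. i \<in> T \<Longrightarrow> \<exists>c\<in>S2. U i \<subseteq> sphere_cap u c"
    and K: "K > 0" "\<And>x z. (\<And>i. i \<in> T \<Longrightarrow> x i \<in> U i) \<Longrightarrow> (\<Sum>i\<in>T. exp (- norm (z - centre n (x i)))) \<le> K"
    and \<rho>: "\<rho> \<ge> 0" and s: "s > 0"
  shows "\<exists>E\<in>sets M. {\<omega> \<in> space M. \<forall>i\<in>T. \<exists>x\<in>U i.
            \<bar>partial_kostlan n (multi_indices n - near_indices n \<rho> (U i)) a \<omega> x\<bar> > s} \<subseteq> E \<and>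
     measure M E \<le> (2 * ((4 / \<delta> + 2) * (u * sqrt n)) ^ 3 *
        exp (- (s\<^sup>2 * exp (\<rho>\<^sup>2 / 72) / (48 * exp 3042 * K)))) ^ card T"
proof -
  interpret prob_space M by fact
  define \<nu> where "\<nu> = ((4 / \<delta> + 2) * (u * sqrt n)) ^ 3"
  have "\<forall>i\<in>T. \<exists>N\<subseteq>U i. finite N \<and> real (card N) \<le> \<nu> \<and>
           (\<forall>x\<in>U i. \<exists>z\<in>N. \<forall>k. \<bar>log_shift n z x $ k\<bar> \<le> 1)"
  proof
    fix i assume i: "i \<in> T"
    obtain c where "c \<in> S2" "U i \<subseteq> sphere_cap u c" using U(3)[OF i] by blast
    from log_shift_net[OF \<delta> U(1)[OF i] U(2)[OF i] this u]
    show "\<exists>N\<subseteq>U i. finite N \<and> real (card N) \<le> \<nu> \<and>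
           (\<forall>x\<in>U i. \<exists>z\<in>N. \<forall>k. \<bar>log_shift n z x $ k\<bar> \<le> 1)" unfolding \<nu>_def .
  qed
  from bchoice[OF this] obtain N where N': "\<forall>i\<in>T. N i \<subseteq> U i \<and> finite (N i) \<and> real (card (N i)) \<le> \<nu> \<and>
      (\<forall>x\<in>U i. \<exists>z\<in>N i. \<forall>k. \<bar>log_shift n z x $ k\<bar> \<le> 1)" ..
  have N: "N i \<subseteq> U i" "finite (N i)" "real (card (N i)) \<le> \<nu>"
      "\<forall>x\<in>U i. \<exists>z\<in>N i. \<forall>k. \<bar>log_shift n z x $ k\<bar> \<le> 1" if "i \<in> T" for i
    using bspec[OF N' that] by simp_all
  define \<Gamma> where "\<Gamma> = PiE T N"
  have \<Gamma>: "finite \<Gamma>" "\<And>\<gamma> i. \<gamma> \<in> \<Gamma> \<Longrightarrow> i \<in> T \<Longrightarrow> \<gamma> i \<in> U i"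
  proof -
    show "finite \<Gamma>" unfolding \<Gamma>_def using N(2) T by (intro finite_PiE) auto
    show "\<gamma> i \<in> U i" if "\<gamma> \<in> \<Gamma>" "i \<in> T" for \<gamma> i using that N(1) unfolding \<Gamma>_def by blast
  qed
  have card_\<Gamma>: "real (card \<Gamma>) \<le> \<nu> ^ card T"
  proof -
    have "real (card \<Gamma>) = (\<Prod>i\<in>T. real (card (N i)))" using T by (simp add: \<Gamma>_def card_PiE)
    also have "\<dots> \<le> (\<Prod>i\<in>T. \<nu>)" by (intro prod_mono) (auto simp: N)
    finally show ?thesis by simp
  qed
  define m where "m = card T"
  have m: "m > 0" using T by (auto simp: m_def card_gt_0_iff)
  define V where "V = 24 * exp 3042 * K * m * exp (- (\<rho>\<^sup>2 / 72))"
  have V: "V > 0" using K m by (simp add: V_def)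
  define \<tau> where "\<tau> = s\<^sup>2 * exp (\<rho>\<^sup>2 / 72) / (48 * exp 3042 * K)"
  have V\<tau>: "(real m * s)\<^sup>2 / (2 * V) = m * \<tau>"
  proof -
    have "2 * V = 48 * exp 3042 * K * m / exp (\<rho>\<^sup>2 / 72)"
      unfolding V_def exp_minus by (simp only: divide_inverse)
    then show ?thesis using m unfolding \<tau>_def by (simp only: divide_divide_eq_right power2_eq_square) (simp add: mult_ac)
  qed
  \<comment> \<open>Indices near any point of \<open>U i\<close> are removed, in particular those near \<open>\<gamma> i\<close>.\<close>
  define c where "c \<gamma> i J = of_bool (J \<notin> near_indices n \<rho> (U i)) * kostlan_basis n J (\<gamma> i)" for \<gamma> i J
  have "\<exists>E\<in>sets M. {\<omega> \<in> space M. \<forall>i\<in>T. \<exists>h :: real ^ 3. (\<forall>k. \<bar>h $ k\<bar> \<le> 1) \<and>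
            \<bar>\<Sum>J\<in>multi_indices n. c \<gamma> i J * exp (\<Sum>k\<in>UNIV. h $ k * deviation n J (\<gamma> i) $ k) * a J \<omega>\<bar> > s} \<subseteq> E \<and>
     measure M E \<le> 2 ^ card T * exp (- ((card T * s)\<^sup>2 / (2 * V)))" if \<gamma>: "\<gamma> \<in> \<Gamma>" for \<gamma>
  proof (rule exponential_sum_sup_tail[OF M _ iid T(1) _ V s])
    have "(\<Sum>J\<in>multi_indices n. (\<Sum>i\<in>T. \<bar>c \<gamma> i J\<bar> * (2 * exp (6 * norm (deviation n J (\<gamma> i)))))\<^sup>2) \<le>
       (\<Sum>J\<in>multi_indices n. (\<Sum>i\<in>T. of_bool (norm (deviation n J (\<gamma> i)) > \<rho>) *
            (\<bar>kostlan_basis n J (\<gamma> i)\<bar> * (2 * exp (6 * norm (deviation n J (\<gamma> i))))))\<^sup>2)"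
    proof (intro sum_mono power_mono sum_nonneg)
      fix J i assume J: "J \<in> multi_indices n" and i: "i \<in> T"
      have "norm (deviation n J (\<gamma> i)) > \<rho>" if "J \<notin> near_indices n \<rho> (U i)"
        using that J \<Gamma>(2)[OF \<gamma> i] by (force simp: near_indices_def)
      then show "\<bar>c \<gamma> i J\<bar> * (2 * exp (6 * norm (deviation n J (\<gamma> i)))) \<le>
          of_bool (norm (deviation n J (\<gamma> i)) > \<rho>) *
            (\<bar>kostlan_basis n J (\<gamma> i)\<bar> * (2 * exp (6 * norm (deviation n J (\<gamma> i)))))"
        by (auto simp: c_def)
    qed auto
    also have "\<dots> \<le> V" unfolding V_def m_def
      using K(2)[of \<gamma>] \<Gamma>(2)[OF \<gamma>] U(1) T n \<rho> by (intro far_coefficients_bound) blast+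
    finally show "(\<Sum>J\<in>multi_indices n. (\<Sum>i\<in>T. \<bar>c \<gamma> i J\<bar> * (2 * exp (6 * norm (deviation n J (\<gamma> i)))))\<^sup>2) \<le> V" .
  qed simp
  then have ex: "\<forall>\<gamma>\<in>\<Gamma>. \<exists>E. E \<in> sets M \<and> {\<omega> \<in> space M. \<forall>i\<in>T. \<exists>h :: real ^ 3. (\<forall>k. \<bar>h $ k\<bar> \<le> 1) \<and>
            \<bar>\<Sum>J\<in>multi_indices n. c \<gamma> i J * exp (\<Sum>k\<in>UNIV. h $ k * deviation n J (\<gamma> i) $ k) * a J \<omega>\<bar> > s} \<subseteq> E \<and>
     measure M E \<le> 2 ^ m * exp (- (m * \<tau>))" unfolding m_def[symmetric] V\<tau> by blast
  from bchoice[OF ex] obtain E where E': "\<forall>\<gamma>\<in>\<Gamma>. E \<gamma> \<in> sets M \<and>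
      {\<omega> \<in> space M. \<forall>i\<in>T. \<exists>h :: real ^ 3. (\<forall>k. \<bar>h $ k\<bar> \<le> 1) \<and>
            \<bar>\<Sum>J\<in>multi_indices n. c \<gamma> i J * exp (\<Sum>k\<in>UNIV. h $ k * deviation n J (\<gamma> i) $ k) * a J \<omega>\<bar> > s} \<subseteq> E \<gamma> \<and>
      measure M (E \<gamma>) \<le> 2 ^ m * exp (- (m * \<tau>))" ..
  note E = bspec[OF E', THEN conjunct1] bspec[OF E', THEN conjunct2, THEN conjunct1]
    bspec[OF E', THEN conjunct2, THEN conjunct2]
  have "measure M (\<Union>\<gamma>\<in>\<Gamma>. E \<gamma>) \<le> (\<Sum>\<gamma>\<in>\<Gamma>. measure M (E \<gamma>))"
    using \<Gamma>(1) E(1) by (intro finite_measure_subadditive_finite) auto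
  also have "\<dots> \<le> (\<Sum>\<gamma>\<in>\<Gamma>. 2 ^ m * exp (- (m * \<tau>)))" by (intro sum_mono E(3))
  also have "\<dots> \<le> \<nu> ^ m * (2 ^ m * exp (- (m * \<tau>)))"
    using card_\<Gamma> by (simp add: m_def mult_right_mono)
  also have "\<dots> = (2 * \<nu> * exp (- \<tau>)) ^ m"
    by (simp add: power_mult_distrib flip: exp_of_nat_mult)
  finally have PE: "measure M (\<Union>\<gamma>\<in>\<Gamma>. E \<gamma>) \<le> (2 * \<nu> * exp (- \<tau>)) ^ card T" by (simp only: m_def)
  have "{\<omega> \<in> space M. \<forall>i\<in>T. \<exists>x\<in>U i.
            \<bar>partial_kostlan n (multi_indices n - near_indices n \<rho> (U i)) a \<omega> x\<bar> > s} \<subseteq> (\<Union>\<gamma>\<in>\<Gamma>. E \<gamma>)"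
  proof safe
    fix \<omega> assume \<omega>: "\<omega> \<in> space M" and "\<forall>i\<in>T. \<exists>x\<in>U i.
            \<bar>partial_kostlan n (multi_indices n - near_indices n \<rho> (U i)) a \<omega> x\<bar> > s"
    from bchoice[OF this(2)[unfolded Bex_def]] obtain x where x': "\<forall>i\<in>T. x i \<in> U i \<and>
        \<bar>partial_kostlan n (multi_indices n - near_indices n \<rho> (U i)) a \<omega> (x i)\<bar> > s" ..
    have x: "x i \<in> U i" "\<bar>partial_kostlan n (multi_indices n - near_indices n \<rho> (U i)) a \<omega> (x i)\<bar> > s"
      if "i \<in> T" for i
      using bspec[OF x' that] by simp_all
    have "\<forall>i\<in>T. \<exists>z. z \<in> N i \<and> (\<forall>k. \<bar>log_shift n z (x i) $ k\<bar> \<le> 1)" using N(4) x(1) by blast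
    from bchoice[OF this] obtain z where z': "\<forall>i\<in>T. z i \<in> N i \<and> (\<forall>k. \<bar>log_shift n (z i) (x i) $ k\<bar> \<le> 1)" ..
    have z: "z i \<in> N i" "\<And>k. \<bar>log_shift n (z i) (x i) $ k\<bar> \<le> 1" if "i \<in> T" for i
      using bspec[OF z' that] by simp_all
    define \<gamma> where "\<gamma> = restrict z T"
    have \<gamma>: "\<gamma> \<in> \<Gamma>" using z(1) by (auto simp: \<gamma>_def \<Gamma>_def)
    have "\<exists>h :: real ^ 3. (\<forall>k. \<bar>h $ k\<bar> \<le> 1) \<and>
            \<bar>\<Sum>J\<in>multi_indices n. c \<gamma> i J * exp (\<Sum>k\<in>UNIV. h $ k * deviation n J (\<gamma> i) $ k) * a J \<omega>\<bar> > s"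
      if i: "i \<in> T" for i
    proof (intro exI conjI allI)
      define h where "h = log_shift n (z i) (x i)"
      show "\<bar>h $ k\<bar> \<le> 1" for k unfolding h_def using z(2)[OF i] .
      have zU: "z i \<in> U i" using z(1) N(1) i by blast
      have orth: "y \<in> S2 \<inter> orthant" if "y \<in> U i" for y
        using U(1,2)[OF i] that \<delta> by (force simp: orthant_def intro: less_le_trans)
      define \<kappa> where "\<kappa> = exp (\<Sum>k\<in>UNIV. h $ k * centre n (z i) $ k)"
      have \<kappa>: "0 < \<kappa>" "\<kappa> \<le> 1"
        using log_shift_centre_nonpos[OF orth[OF x(1)[OF i]] orth[OF zU]] by (auto simp: \<kappa>_def h_def)
      define \<Sigma> where "\<Sigma> = (\<Sum>J\<in>multi_indices n. c \<gamma> i J * exp (\<Sum>k\<in>UNIV. h $ k * deviation n J (\<gamma> i) $ k) * a J \<omega>)"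
      have "\<Sigma> = (\<Sum>J\<in>multi_indices n - near_indices n \<rho> (U i).
          kostlan_basis n J (z i) * exp (\<Sum>k\<in>UNIV. h $ k * deviation n J (z i) $ k) * a J \<omega>)"
        unfolding \<Sigma>_def using i by (intro sum.mono_neutral_cong_right) (auto simp: c_def \<gamma>_def)
      then have "partial_kostlan n (multi_indices n - near_indices n \<rho> (U i)) a \<omega> (x i) = \<kappa> * \<Sigma>"
        using kostlan_basis_shift[OF n, of "x i" "z i"] orth[OF x(1)[OF i]] orth[OF zU]
        by (simp add: partial_kostlan_def sum_distrib_left \<kappa>_def h_def mult.assoc)
      then have "s < \<kappa> * \<bar>\<Sigma>\<bar>" using x(2)[OF i] \<kappa> by (simp add: abs_mult)
      also have "\<dots> \<le> \<bar>\<Sigma>\<bar>" using \<kappa> by (simp add: mult_left_le_one_le)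
      finally show "s < \<bar>\<Sum>J\<in>multi_indices n. c \<gamma> i J * exp (\<Sum>k\<in>UNIV. h $ k * deviation n J (\<gamma> i) $ k) * a J \<omega>\<bar>"
        by (simp only: \<Sigma>_def)
    qed
    then have "\<omega> \<in> E \<gamma>" using E(2)[OF \<gamma>] \<omega> by blast
    then show "\<omega> \<in> (\<Union>\<gamma>\<in>\<Gamma>. E \<gamma>)" using \<gamma> by blast
  qed
  moreover have "(\<Union>\<gamma>\<in>\<Gamma>. E \<gamma>) \<in> sets M" using \<Gamma>(1) E(1) by auto
  ultimately show ?thesis using PE unfolding \<nu>_def \<tau>_def by blast
qed

section \<open>Increasing events and independence of the truncated fields\<close>

lemma restriction_algebra_cong:
  assumes "A \<in> sets (restriction_algebra U)" "g \<in> C_S2" "g' \<in> C_S2" "\<And>x. x \<in> U \<Longrightarrow> g x = g' x" "g \<in> A"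
  shows "g' \<in> A"
proof -
  have "(\<lambda>g. restrict g U) \<in> C_S2 \<rightarrow> space (Pi\<^sub>M U (\<lambda>_. borel :: real measure))"
    by (auto simp: space_PiM)
  from sets_vimage_algebra2[OF this] assms(1)
  obtain B where B: "A = (\<lambda>g. restrict g U) -` B \<inter> C_S2"
    unfolding restriction_algebra_def by blast
  have "restrict g U = restrict g' U" using assms(4) by (intro restrict_ext) auto
  then show ?thesis using assms B by auto
qed

text \<open>The event only sees \<open>U\<close>, so domination on \<open>U\<close> suffices: \<open>g\<close> is raised to the
maximum of \<open>g\<close> and \<open>g'\<close>, which is a continuous nonnegative change and agrees with
\<open>g'\<close> on \<open>U\<close>.\<close>

lemma increasing_event_mono_on:
  assumes A: "A \<in> sets (restriction_algebra U)" "increasing_event A" and U: "U \<subseteq> S2"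
    and g: "g \<in> A" "g \<in> C_S2" "g' \<in> C_S2" "\<And>x. x \<in> U \<Longrightarrow> g x \<le> g' x"
  shows "g' \<in> A"
proof -
  define s where "s x = max 0 (g' x - g x)" for x
  have "s \<in> C_S2" using g(2,3) unfolding s_def C_S2_def by (auto intro!: continuous_intros)
  then have "(\<lambda>x. g x + s x) \<in> A" "(\<lambda>x. g x + s x) \<in> C_S2"
    using A(2) g(1,2) by (auto simp: increasing_event_def s_def C_S2_def intro!: continuous_intros)
  then show ?thesis
    using g(4) by (intro restriction_algebra_cong[OF A(1) _ g(3), of "\<lambda>x. g x + s x"]) (auto simp: s_def max_def)
qed

lemma continuous_kostlan_basis: "continuous_on S (kostlan_basis n J)"
  unfolding kostlan_basis_def[abs_def] by (intro continuous_intros)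

lemma kostlan_eq_partial: "kostlan n a \<omega> = partial_kostlan n (multi_indices n) a \<omega>"
  by (simp add: fun_eq_iff kostlan_def partial_kostlan_def kostlan_basis_def mult_ac)

lemma partial_kostlan_split:
  "F \<subseteq> multi_indices n \<Longrightarrow>
    kostlan n a \<omega> x = partial_kostlan n F a \<omega> x + partial_kostlan n (multi_indices n - F) a \<omega> x"
  unfolding kostlan_eq_partial partial_kostlan_def
  by (subst sum.subset_diff[OF _ finite_multi_indices]) (simp_all add: add.commute)

lemma partial_kostlan_C_S2: "(\<lambda>x. partial_kostlan n F a \<omega> x + t) \<in> C_S2"
  unfolding C_S2_def partial_kostlan_def by (auto intro!: continuous_intros continuous_kostlan_basis)

lemma partial_kostlan_path_measurable:
  assumes "finite F"
  shows "(\<lambda>c x. (\<Sum>J\<in>F. kostlan_basis n J x * c J) + t)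
    \<in> Pi\<^sub>M F (\<lambda>_. borel) \<rightarrow>\<^sub>M restriction_algebra U"
  unfolding restriction_algebra_def
proof (rule measurable_vimage_algebra2)
  show "(\<lambda>c x. (\<Sum>J\<in>F. kostlan_basis n J x * c J) + t) \<in> space (Pi\<^sub>M F (\<lambda>_. borel)) \<rightarrow> C_S2"
    by (auto simp: C_S2_def intro!: continuous_intros continuous_kostlan_basis)
  show "(\<lambda>c. restrict (\<lambda>x. (\<Sum>J\<in>F. kostlan_basis n J x * c J) + t) U)
    \<in> Pi\<^sub>M F (\<lambda>_. borel) \<rightarrow>\<^sub>M Pi\<^sub>M U (\<lambda>_. borel)"
    by (intro measurable_restrict borel_measurable_add borel_measurable_sum borel_measurable_times
        measurable_component_singleton borel_measurable_const)
qed

text \<open>The truncated fields are measurable functions of disjoint blocks of the independent coefficients.\<close>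

lemma partial_kostlan_events:
  assumes M: "prob_space M" and iid: "iid_std_gaussian M (multi_indices n) a"
    and F: "\<And>i. i \<in> T \<Longrightarrow> F i \<subseteq> multi_indices n" "disjoint_family_on F T" and T: "finite T"
    and A: "\<And>i. i \<in> T \<Longrightarrow> A i \<in> sets (restriction_algebra (U i))"
  shows "\<And>i. i \<in> T \<Longrightarrow> {\<omega> \<in> space M. (\<lambda>x. partial_kostlan n (F i) a \<omega> x + t) \<in> A i} \<in> sets M"
    and "measure M {\<omega> \<in> space M. \<forall>i\<in>T. (\<lambda>x. partial_kostlan n (F i) a \<omega> x + t) \<in> A i} =
      (\<Prod>i\<in>T. measure M {\<omega> \<in> space M. (\<lambda>x. partial_kostlan n (F i) a \<omega> x + t) \<in> A i})"
proof -
  interpret prob_space M by fact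
  have "indep_vars (\<lambda>_. borel) a (multi_indices n)" using iid by (simp add: iid_std_gaussian_def)
  then have "indep_vars (\<lambda>i. Pi\<^sub>M (F i) (\<lambda>_. borel)) (\<lambda>i \<omega>. restrict (\<lambda>J. a J \<omega>) (F i)) T"
    using F by (rule indep_vars_restrict)
  then have "indep_vars (\<lambda>i. restriction_algebra (U i))
      (\<lambda>i \<omega>. (\<lambda>c x. (\<Sum>J\<in>F i. kostlan_basis n J x * c J) + t) (restrict (\<lambda>J. a J \<omega>) (F i))) T"
    by (rule indep_vars_compose2) (use F finite_subset[OF _ finite_multi_indices] in
      \<open>blast intro: partial_kostlan_path_measurable\<close>)
  also have "(\<lambda>i \<omega>. (\<lambda>c x. (\<Sum>J\<in>F i. kostlan_basis n J x * c J) + t) (restrict (\<lambda>J. a J \<omega>) (F i))) =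
      (\<lambda>i \<omega> x. partial_kostlan n (F i) a \<omega> x + t)"
    by (simp add: partial_kostlan_def fun_eq_iff)
  finally have ind: "indep_vars (\<lambda>i. restriction_algebra (U i)) (\<lambda>i \<omega> x. partial_kostlan n (F i) a \<omega> x + t) T" .
  have eq: "{\<omega> \<in> space M. (\<lambda>x. partial_kostlan n (F i) a \<omega> x + t) \<in> A i} =
      (\<lambda>\<omega> x. partial_kostlan n (F i) a \<omega> x + t) -` A i \<inter> space M" for i by auto
  show "{\<omega> \<in> space M. (\<lambda>x. partial_kostlan n (F i) a \<omega> x + t) \<in> A i} \<in> sets M" if "i \<in> T" for i
    unfolding eq using ind A[OF that] that by (auto simp: indep_vars_def intro: measurable_sets)
  show "measure M {\<omega> \<in> space M. \<forall>i\<in>T. (\<lambda>x. partial_kostlan n (F i) a \<omega> x + t) \<in> A i} =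
      (\<Prod>i\<in>T. measure M {\<omega> \<in> space M. (\<lambda>x. partial_kostlan n (F i) a \<omega> x + t) \<in> A i})"
  proof (cases "T = {}")
    case True
    then show ?thesis by (simp add: prob_space)
  next
    case False
    have "{\<omega> \<in> space M. \<forall>i\<in>T. (\<lambda>x. partial_kostlan n (F i) a \<omega> x + t) \<in> A i} =
        (\<Inter>i\<in>T. (\<lambda>\<omega> x. partial_kostlan n (F i) a \<omega> x + t) -` A i \<inter> space M)" using False by auto
    then show ?thesis unfolding eq using indep_varsD_finite[OF ind False T A] by simp
  qed
qed

lemma centres_separated:
  assumes \<delta>: "\<delta> > 0" and U: "\<forall>i\<in>T. U i \<subseteq> S2 \<and> (\<forall>x\<in>U i. \<forall>k. x $ k \<ge> \<delta>)"
    and sep: "\<forall>i\<in>T. \<forall>j\<in>T. i \<noteq> j \<longrightarrow> (\<forall>x\<in>U i. \<forall>y\<in>U j. sphere_dist x y \<ge> r)"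
    and ij: "i \<in> T" "j \<in> T" "i \<noteq> j" "x \<in> U i" "y \<in> U j"
  shows "norm (centre n x - centre n y) \<ge> 2 / 3 * \<delta> * (r * sqrt n)"
proof -
  have S2: "x \<in> S2" "y \<in> S2" and coord: "\<And>k. x $ k \<ge> \<delta>" "\<And>k. y $ k \<ge> \<delta>"
    using U ij by blast+
  have "r \<le> sphere_dist x y" using sep ij by blast
  then have "r \<le> 3 * norm (x - y)" using sphere_dist_le_norm_diff[OF S2] by linarith
  then have "2 / 3 * \<delta> * sqrt n * r \<le> 2 / 3 * \<delta> * sqrt n * (3 * norm (x - y))"
    using \<delta> by (intro mult_left_mono) auto
  also have "\<dots> = 2 * \<delta> * sqrt n * norm (x - y)" by simp
  also have "\<dots> \<le> norm (centre n x - centre n y)"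
    using centre_separation[OF \<delta> coord] .
  finally show ?thesis by (simp add: mult_ac)
qed

text \<open>The centres of points from different sets are at distance at least \<open>2/3 * \<delta> * r * sqrt n\<close>,
more than twice the truncation radius, so no index is near both.\<close>

lemma disjoint_near_indices:
  assumes n: "n \<ge> 1" and r: "r > 0" and \<delta>: "\<delta> > 0"
    and U: "\<forall>i\<in>T. U i \<subseteq> S2 \<and> (\<forall>x\<in>U i. \<forall>k. x $ k \<ge> \<delta>)"
    and sep: "\<forall>i\<in>T. \<forall>j\<in>T. i \<noteq> j \<longrightarrow> (\<forall>x\<in>U i. \<forall>y\<in>U j. sphere_dist x y \<ge> r)"
  shows "disjoint_family_on (\<lambda>i. near_indices n (\<delta> * (r * sqrt n) / 4) (U i)) T"
proof (unfold disjoint_family_on_def, intro ballI impI, rule ccontr)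
  fix i j assume ij: "i \<in> T" "j \<in> T" "i \<noteq> j"
    "near_indices n (\<delta> * (r * sqrt n) / 4) (U i) \<inter> near_indices n (\<delta> * (r * sqrt n) / 4) (U j) \<noteq> {}"
  then obtain J x y where xy: "x \<in> U i" "norm (deviation n J x) \<le> \<delta> * (r * sqrt n) / 4"
      "y \<in> U j" "norm (deviation n J y) \<le> \<delta> * (r * sqrt n) / 4"
    by (auto simp: near_indices_def)
  have "centre n x - centre n y = deviation n J y - deviation n J x" by (simp add: deviation_eq)
  then have "norm (centre n x - centre n y) \<le> \<delta> * (r * sqrt n) / 4 + \<delta> * (r * sqrt n) / 4"
    using norm_triangle_ineq4[of "deviation n J y" "deviation n J x"] xy by simp
  moreover have "\<delta> * (r * sqrt n) > 0" using \<delta> r n by simp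
  ultimately show False using centres_separated[OF \<delta> U sep ij(1-3) xy(1,3), of n] by simp
qed

section \<open>From rare errors to the decoupling inequalities\<close>

lemma prod_le_prod_add:
  fixes g p :: "'i \<Rightarrow> real" and \<beta> :: real
  assumes "finite T" "\<And>i. i \<in> T \<Longrightarrow> 0 \<le> g i \<and> g i \<le> 1" "\<And>i. i \<in> T \<Longrightarrow> 0 \<le> p i \<and> p i \<le> 1"
    "\<And>i. i \<in> T \<Longrightarrow> g i \<le> p i + \<beta>" "\<beta> \<ge> 0"
  shows "(\<Prod>i\<in>T. g i) \<le> (\<Prod>i\<in>T. p i) + card T * \<beta>"
  using assms(1-4)
proof (induction T rule: finite_induct)
  case (insert i T)
  have IH: "(\<Prod>i\<in>T. g i) \<le> (\<Prod>i\<in>T. p i) + card T * \<beta>" using insert by auto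
  have gi: "0 \<le> g i" "g i \<le> 1" "g i \<le> p i + \<beta>" and P: "0 \<le> (\<Prod>i\<in>T. p i)" "(\<Prod>i\<in>T. p i) \<le> 1"
    using insert.prems by (auto intro!: prod_nonneg prod_le_1)
  have "g i * (\<Prod>i\<in>T. g i) \<le> g i * ((\<Prod>i\<in>T. p i) + card T * \<beta>)"
    using IH gi by (intro mult_left_mono) auto
  also have "\<dots> = g i * (\<Prod>i\<in>T. p i) + g i * (card T * \<beta>)" by (simp add: distrib_left)
  also have "\<dots> \<le> (p i + \<beta>) * (\<Prod>i\<in>T. p i) + 1 * (card T * \<beta>)"
    using gi P assms(5) by (intro add_mono mult_right_mono mult_nonneg_nonneg) auto
  also have "\<dots> \<le> p i * (\<Prod>i\<in>T. p i) + \<beta> + card T * \<beta>"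
    using P mult_left_mono[OF P(2) assms(5)] by (simp add: distrib_right)
  finally show ?case using insert.hyps by (simp add: algebra_simps)
qed simp

text \<open>\<open>F\<close> are the original events, \<open>G\<close> the independent ones obtained by truncating and
raising the level by one half of the sprinkling, \<open>H\<close> the events at the fully raised level, and
\<open>bad\<close> the events that a truncation error is large. For the first inequality all errors are
excluded at once. For the second, \<open>T\<close> records which \<open>G i\<close> occur: if all
\<open>F i\<close> occur, then on the complement of \<open>T\<close> all errors are large, and one of the two sets has at least
\<open>k / 2\<close> elements, while there are only \<open>2 ^ k = 4 powr (k / 2)\<close> choices of
\<open>T\<close>.\<close>

lemma decoupling_of_rare_errors:
  fixes F G H bad :: "nat \<Rightarrow> 'w set" and \<beta> :: real
  assumes M: "prob_space M" and k: "k \<ge> 1"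
    and G: "\<And>i. i \<in> {1..k} \<Longrightarrow> G i \<in> sets M"
      "\<And>T. T \<subseteq> {1..k} \<Longrightarrow> measure M {\<omega> \<in> space M. \<forall>i\<in>T. \<omega> \<in> G i} = (\<Prod>i\<in>T. measure M (G i))"
    and H: "\<And>i. i \<in> {1..k} \<Longrightarrow> H i \<in> sets M"
    and bad: "\<And>T. T \<subseteq> {1..k} \<Longrightarrow> T \<noteq> {} \<Longrightarrow>
       \<exists>E\<in>sets M. {\<omega> \<in> space M. \<forall>i\<in>T. \<omega> \<in> bad i} \<subseteq> E \<and> measure M E \<le> \<beta> ^ card T"
    and FG: "\<And>i. i \<in> {1..k} \<Longrightarrow> F i \<subseteq> G i \<union> bad i" and GH: "\<And>i. i \<in> {1..k} \<Longrightarrow> G i \<subseteq> H i \<union> bad i"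
    and \<beta>: "0 < \<beta>" "\<beta> \<le> 1"
  shows "measure M {\<omega> \<in> space M. \<forall>i\<in>{1..k}. \<omega> \<in> F i} \<le> (\<Prod>i\<in>{1..k}. measure M (H i)) + 2 * (k * \<beta>)" (is "?P \<le> _")
    and "measure M {\<omega> \<in> space M. \<forall>i\<in>{1..k}. \<omega> \<in> F i} \<le>
      (8 * (SUP i\<in>{1..k}. measure M (H i))) powr (k / 2) + (8 * \<beta>) powr (k / 2)"
proof -
  interpret prob_space M by fact
  have "\<forall>T\<in>Pow {1..k}. \<exists>E. E \<in> sets M \<and> {\<omega> \<in> space M. \<forall>i\<in>T. \<omega> \<in> bad i} \<subseteq> E \<and> measure M E \<le> \<beta> ^ card T"
  proof
    fix T assume T: "T \<in> Pow {1..k}"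
    show "\<exists>E. E \<in> sets M \<and> {\<omega> \<in> space M. \<forall>i\<in>T. \<omega> \<in> bad i} \<subseteq> E \<and> measure M E \<le> \<beta> ^ card T"
    proof (cases "T = {}")
      case True
      then show ?thesis by (intro exI[of _ "space M"]) auto
    next
      case False
      then show ?thesis using bad[of T] T by blast
    qed
  qed
  from bchoice[OF this] obtain E where E': "\<forall>T\<in>Pow {1..k}. E T \<in> sets M \<and>
      {\<omega> \<in> space M. \<forall>i\<in>T. \<omega> \<in> bad i} \<subseteq> E T \<and> measure M (E T) \<le> \<beta> ^ card T" ..
  have E: "E T \<in> sets M" "\<And>\<omega>. \<omega> \<in> space M \<Longrightarrow> \<forall>i\<in>T. \<omega> \<in> bad i \<Longrightarrow> \<omega> \<in> E T" "measure M (E T) \<le> \<beta> ^ card T"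
    if "T \<subseteq> {1..k}" for T
    using E' that by auto
  have Gsub: "G i \<subseteq> space M" if "i \<in> {1..k}" for i using G(1)[OF that] by (rule sets.sets_into_space)
  have P_G: "prob (G i) \<le> prob (H i) + \<beta>" if i: "i \<in> {1..k}" for i
  proof -
    have "G i \<subseteq> H i \<union> E {i}" using GH[OF i] E(2)[of "{i}"] Gsub[OF i] i by fastforce
    then have "prob (G i) \<le> prob (H i \<union> E {i})"
      using H[OF i] E(1)[of "{i}"] i by (intro finite_measure_mono) auto
    also have "\<dots> \<le> prob (H i) + prob (E {i})"
      using H[OF i] E(1)[of "{i}"] i by (intro measure_Un_le) auto
    finally show ?thesis using E(3)[of "{i}"] i by simp
  qed
  have G_sets: "{\<omega> \<in> space M. \<forall>i\<in>T. \<omega> \<in> G i} \<in> sets M" if "T \<subseteq> {1..k}" for T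
  proof -
    have "finite T" using that finite_subset by blast
    moreover have "{\<omega> \<in> space M. \<omega> \<in> G i} \<in> sets M" if "i \<in> T" for i
    proof -
      have i: "i \<in> {1..k}" using that \<open>T \<subseteq> {1..k}\<close> by blast
      have "{\<omega> \<in> space M. \<omega> \<in> G i} = G i" using Gsub[OF i] by blast
      then show ?thesis using G(1)[OF i] by simp
    qed
    ultimately show ?thesis by (intro sets.sets_Collect_finite_All)
  qed

  have "?P \<le> prob ({\<omega> \<in> space M. \<forall>i\<in>{1..k}. \<omega> \<in> G i} \<union> (\<Union>i\<in>{1..k}. E {i}))"
  proof (rule finite_measure_mono)
    show "{\<omega> \<in> space M. \<forall>i\<in>{1..k}. \<omega> \<in> F i} \<subseteq> {\<omega> \<in> space M. \<forall>i\<in>{1..k}. \<omega> \<in> G i} \<union> (\<Union>i\<in>{1..k}. E {i})"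
    proof
      fix \<omega> assume \<omega>: "\<omega> \<in> {\<omega> \<in> space M. \<forall>i\<in>{1..k}. \<omega> \<in> F i}"
      show "\<omega> \<in> {\<omega> \<in> space M. \<forall>i\<in>{1..k}. \<omega> \<in> G i} \<union> (\<Union>i\<in>{1..k}. E {i})"
      proof (cases "\<forall>i\<in>{1..k}. \<omega> \<in> G i")
        case False
        then obtain i where "i \<in> {1..k}" "\<omega> \<in> bad i" using \<omega> FG by blast
        then have "\<omega> \<in> E {i}" using E(2)[of "{i}" \<omega>] \<omega> by simp
        with \<open>i \<in> {1..k}\<close> show ?thesis by blast
      qed (use \<omega> in blast)
    qed
  qed (use G_sets E(1) in auto)
  also have "\<dots> \<le> prob {\<omega> \<in> space M. \<forall>i\<in>{1..k}. \<omega> \<in> G i} + prob (\<Union>i\<in>{1..k}. E {i})"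
    using G_sets E(1) by (intro measure_Un_le) auto
  also have "prob (\<Union>i\<in>{1..k}. E {i}) \<le> (\<Sum>i\<in>{1..k}. prob (E {i}))"
    using E(1) by (intro finite_measure_subadditive_finite) auto
  also have "(\<Sum>i\<in>{1..k}. prob (E {i})) \<le> (\<Sum>i\<in>{1..k}. \<beta>)"
    using E(3)[of "{_}"] by (intro sum_mono) auto
  also have "prob {\<omega> \<in> space M. \<forall>i\<in>{1..k}. \<omega> \<in> G i} = (\<Prod>i\<in>{1..k}. prob (G i))" by (rule G(2)) simp
  also have "(\<Prod>i\<in>{1..k}. prob (G i)) \<le> (\<Prod>i\<in>{1..k}. prob (H i)) + card {1..k} * \<beta>"
    using P_G \<beta> by (intro prod_le_prod_add) auto
  finally show "?P \<le> (\<Prod>i\<in>{1..k}. measure M (H i)) + 2 * (k * \<beta>)" by (simp add: algebra_simps)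

  define p where "p = (SUP i\<in>{1..k}. prob (H i))"
  have p: "prob (H i) \<le> p" if "i \<in> {1..k}" for i
    unfolding p_def using that by (intro cSUP_upper) auto
  have p0: "p \<ge> 0" using order_trans[OF measure_nonneg p[of 1]] k by simp
  define \<theta> where "\<theta> = min 1 (p + \<beta>)"
  have \<theta>: "0 < \<theta>" "\<theta> \<le> 1" "\<beta> \<le> \<theta>" using p0 \<beta> by (auto simp: \<theta>_def)
  have term_le: "prob ({\<omega> \<in> space M. \<forall>i\<in>T. \<omega> \<in> G i} \<inter> E ({1..k} - T)) \<le> \<theta> powr (k / 2)" if T: "T \<subseteq> {1..k}" for T
  proof -
    let ?L = "prob ({\<omega> \<in> space M. \<forall>i\<in>T. \<omega> \<in> G i} \<inter> E ({1..k} - T))"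
    have fin: "finite T" using T finite_subset by blast
    have "?L \<le> prob {\<omega> \<in> space M. \<forall>i\<in>T. \<omega> \<in> G i}"
      using G_sets[OF T] by (intro finite_measure_mono) auto
    also have "\<dots> = (\<Prod>i\<in>T. prob (G i))" by (rule G(2)[OF T])
    also have "\<dots> \<le> (\<Prod>i\<in>T. \<theta>)"
      using P_G p T by (intro prod_mono) (force simp: \<theta>_def)
    finally have 1: "?L \<le> \<theta> powr card T" using \<theta> by (simp add: powr_realpow)
    have "?L \<le> prob (E ({1..k} - T))" using E(1)[of "{1..k} - T"] by (intro finite_measure_mono) auto
    also have "\<dots> \<le> \<beta> ^ card ({1..k} - T)" by (rule E(3)) auto
    also have "\<dots> \<le> \<theta> ^ card ({1..k} - T)" using \<beta> \<theta> by (intro power_mono) auto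
    also have "card ({1..k} - T) = k - card T" using T fin by (simp add: card_Diff_subset)
    finally have 2: "?L \<le> \<theta> powr real (k - card T)" using \<theta> by (simp add: powr_realpow)
    have "real (card T) \<ge> k / 2 \<or> real (k - card T) \<ge> k / 2" by linarith
    then show ?thesis using 1 2 \<theta> powr_mono'[of "k / 2" _ \<theta>] by (meson less_imp_le order_trans)
  qed
  have "?P \<le> prob (\<Union>T\<in>Pow {1..k}. {\<omega> \<in> space M. \<forall>i\<in>T. \<omega> \<in> G i} \<inter> E ({1..k} - T))"
  proof (rule finite_measure_mono)
    show "{\<omega> \<in> space M. \<forall>i\<in>{1..k}. \<omega> \<in> F i} \<subseteq> (\<Union>T\<in>Pow {1..k}. {\<omega> \<in> space M. \<forall>i\<in>T. \<omega> \<in> G i} \<inter> E ({1..k} - T))"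
    proof
      fix \<omega> assume \<omega>: "\<omega> \<in> {\<omega> \<in> space M. \<forall>i\<in>{1..k}. \<omega> \<in> F i}"
      let ?T = "{i \<in> {1..k}. \<omega> \<in> G i}"
      have "\<omega> \<in> E ({1..k} - ?T)"
      proof (rule E(2))
        show "\<forall>i\<in>{1..k} - ?T. \<omega> \<in> bad i" using \<omega> FG by blast
      qed (use \<omega> in auto)
      then show "\<omega> \<in> (\<Union>T\<in>Pow {1..k}. {\<omega> \<in> space M. \<forall>i\<in>T. \<omega> \<in> G i} \<inter> E ({1..k} - T))"
        using \<omega> by (intro UN_I[of ?T]) auto
    qed
    show "(\<Union>T\<in>Pow {1..k}. {\<omega> \<in> space M. \<forall>i\<in>T. \<omega> \<in> G i} \<inter> E ({1..k} - T)) \<in> sets M"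
      using G_sets E(1) by (intro sets.finite_UN sets.Int) auto
  qed
  also have "\<dots> \<le> (\<Sum>T\<in>Pow {1..k}. prob ({\<omega> \<in> space M. \<forall>i\<in>T. \<omega> \<in> G i} \<inter> E ({1..k} - T)))"
    using G_sets E(1) by (intro finite_measure_subadditive_finite) (auto intro!: sets.Int)
  also have "\<dots> \<le> (\<Sum>T\<in>Pow {1..k}. \<theta> powr (k / 2))" using term_le by (intro sum_mono) auto
  also have "\<dots> = 2 ^ k * \<theta> powr (k / 2)" by (simp add: card_Pow)
  also have "(2 :: real) ^ k = 4 powr (k / 2)"
    using powr_powr[of 2 2 "k / 2"] by (simp add: powr_realpow)
  also have "4 powr (k / 2) * \<theta> powr (k / 2) = (4 * \<theta>) powr (k / 2)" using \<theta> by (simp add: powr_mult)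
  also have "\<dots> \<le> (8 * max p \<beta>) powr (k / 2)"
    using \<theta> by (intro powr_mono2) (auto simp: \<theta>_def)
  also have "\<dots> \<le> (8 * p) powr (k / 2) + (8 * \<beta>) powr (k / 2)"
    by (cases "p \<le> \<beta>") (auto simp: max_def)
  finally show "?P \<le> (8 * (SUP i\<in>{1..k}. measure M (H i))) powr (k / 2) + (8 * \<beta>) powr (k / 2)"
    unfolding p_def .
qed

section \<open>Choice of the constants\<close>

text \<open>The lower bound imposed on \<open>t\<close> makes the Gaussian exponent \<open>b * Q\<close> a large multiple of
\<open>ln (2 * w)\<close>, so half of it pays for the polynomial number of cells; the second bound lets
half of what remains absorb a factor \<open>8\<close>.\<close>

lemma net_union_bound_absorbed:
  fixes b C w Q c1 :: real
  assumes b: "b > 0" and C: "C \<ge> 1" and w: "w \<ge> 1"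
    and c1: "c1 \<ge> 1" "c1 \<ge> 2 * (10 + 3 * ln C / ln 2) / b" and Q: "Q \<ge> c1\<^sup>2 * ln (2 * w)"
  shows "2 * (C * w) ^ 3 * exp (- (b * Q)) \<le> exp (- (b / 2 * Q))" "b / 2 * Q \<ge> 6 * ln 2"
proof -
  define l where "l = ln (2 * w)"
  have l: "l \<ge> ln 2" using w by (simp add: l_def)
  have ln2: "ln 2 > (0 :: real)" by simp
  have l0: "l > 0" using l ln2 by linarith
  have lnC: "ln C \<ge> 0" using C by simp
  have "c1 \<le> c1\<^sup>2" using c1 by (simp add: power2_eq_square)
  then have "2 * (10 + 3 * ln C / ln 2) / b * l \<le> Q"
    using Q c1(2) l0 mult_right_mono[of "2 * (10 + 3 * ln C / ln 2) / b" "c1\<^sup>2" l] unfolding l_def by linarith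
  then have "b / 2 * (2 * (10 + 3 * ln C / ln 2) / b * l) \<le> b / 2 * Q" using b by (intro mult_left_mono) auto
  moreover have "b / 2 * (2 * m / b * l) = m * l" for m using b by simp
  ultimately have "(10 + 3 * ln C / ln 2) * l \<le> b / 2 * Q" by metis
  then have main: "10 * l + 3 * ln C / ln 2 * l \<le> b / 2 * Q" by (simp only: distrib_right)
  have "3 * ln C / ln 2 * ln 2 \<le> 3 * ln C / ln 2 * l" using l lnC ln2 by (intro mult_left_mono) auto
  then have C_le: "3 * ln C \<le> 3 * ln C / ln 2 * l" by simp
  show "b / 2 * Q \<ge> 6 * ln 2" using main C_le lnC l l0 by linarith
  have "ln (2 * (C * w) ^ 3) = ln 2 + (3 * ln C + 3 * ln w)"
    using C w by (simp add: ln_mult ln_realpow)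
  also have "\<dots> \<le> b / 2 * Q"
  proof -
    have "l = ln 2 + ln w" "ln w \<ge> 0" using w by (simp_all add: l_def ln_mult)
    then show ?thesis using main C_le ln2 by linarith
  qed
  finally have "2 * (C * w) ^ 3 \<le> exp (b / 2 * Q)"
    using C w by (subst (asm) exp_le_cancel_iff[symmetric]) (simp add: exp_ln)
  then have "2 * (C * w) ^ 3 * exp (- (b * Q)) \<le> exp (b / 2 * Q) * exp (- (b * Q))"
    by (intro mult_right_mono) auto
  also have "\<dots> = exp (- (b / 2 * Q))" by (simp flip: exp_add)
  finally show "2 * (C * w) ^ 3 * exp (- (b * Q)) \<le> exp (- (b / 2 * Q))" .
qed

theorem proposition3p12:
  fixes \<U> :: "(real ^ 3) set"
  assumes "compact \<U>" and "\<U> \<subseteq> S2 \<inter> orthant"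
  shows "\<exists>c1 c2 :: real. c1 > 0 \<and> c2 > 0 \<and>
    (\<forall>(M :: 'w measure) (a :: nat ^ 3 \<Rightarrow> 'w \<Rightarrow> real) (n :: nat) (r :: real) (u :: real)
       (k :: nat) (A :: nat \<Rightarrow> (real ^ 3 \<Rightarrow> real) set) (t :: real).
       prob_space M \<longrightarrow> n \<ge> 1 \<longrightarrow> iid_std_gaussian M (multi_indices n) a \<longrightarrow>
       r \<ge> 1 / sqrt (real n) \<longrightarrow> u \<ge> 1 / sqrt (real n) \<longrightarrow>
       k \<ge> 1 \<longrightarrow> class_E \<U> r u k A \<longrightarrow>
       t \<ge> c1 * sqrt (ln (2 * u * sqrt (real n))) * exp (- c2 * r\<^sup>2 * real n) \<longrightarrow>
         \<P>(\<omega> in M. \<forall>i\<in>{1..k}. kostlan n a \<omega> \<in> A i)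
           \<le> (\<Prod>i\<in>{1..k}. \<P>(\<omega> in M. (\<lambda>x. kostlan n a \<omega> x + t) \<in> A i))
              + c1 * real k * exp (- c2 * t\<^sup>2 * exp (c2 * r\<^sup>2 * real n))
       \<and> \<P>(\<omega> in M. \<forall>i\<in>{1..k}. kostlan n a \<omega> \<in> A i)
           \<le> (c1 * (SUP i\<in>{1..k}. \<P>(\<omega> in M. (\<lambda>x. kostlan n a \<omega> x + t) \<in> A i)))
                powr (c2 * real k)
              + c1 * exp (- c2 * real k * t\<^sup>2 * exp (c2 * r\<^sup>2 * real n)))"
proof -
  obtain \<delta> where \<delta>: "\<delta> > 0" "\<And>x k. x \<in> \<U> \<Longrightarrow> x $ k \<ge> \<delta>"
    using compact_orthant_coordinates_bounded_below[of \<U>] assms by blast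
  have "2 / 3 * \<delta> > 0" using \<delta>(1) by simp
  from separated_exp_sum_bounded[OF this] obtain K where K': "K > 0 \<and>
      (\<forall>(T :: nat set) (q :: nat \<Rightarrow> real ^ 3) z. finite T \<longrightarrow>
        (\<forall>i\<in>T. \<forall>j\<in>T. i \<noteq> j \<longrightarrow> norm (q i - q j) \<ge> 2 / 3 * \<delta>) \<longrightarrow>
        (\<Sum>i\<in>T. exp (- norm (z - q i))) \<le> K)" ..
  then have K: "(\<Sum>i\<in>T. exp (- norm (z - q i))) \<le> K"
    if "finite T" "\<And>i j. i \<in> T \<Longrightarrow> j \<in> T \<Longrightarrow> i \<noteq> j \<Longrightarrow> norm (q i - q j) \<ge> 2 / 3 * \<delta>"
    for T :: "nat set" and q :: "nat \<Rightarrow> real ^ 3" and z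
    using that by simp_all
  have K0: "K > 0" using K' ..
  \<comment> \<open>The constant of the Gaussian exponent in the tail of the truncation errors at level \<open>t / 2\<close>.\<close>
  define b where "b = 1 / (192 * exp 3042 * K)"
  have b: "b > 0" using K0 by (simp add: b_def)
  \<comment> \<open>With the truncation radius \<open>\<rho> = \<delta> * (r * sqrt n) / 4\<close> the multinomial tail \<open>exp (- (\<rho>\<^sup>2 / 72))\<close> is \<open>exp (- (c * r\<^sup>2 * n))\<close>.\<close>
  define c where "c = \<delta>\<^sup>2 / 1152"
  have c: "c > 0" using \<delta>(1) by (simp add: c_def)
  define C where "C = 4 / \<delta> + 2"
  have C: "C \<ge> 1" using \<delta>(1) by (simp add: C_def add_increasing)
  define c1 where "c1 = 8 + 2 * (10 + 3 * ln C / ln 2) / b"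
  have c1: "c1 \<ge> 8" "c1 \<ge> 2 * (10 + 3 * ln C / ln 2) / b" using b C by (auto simp: c1_def)
  \<comment> \<open>\<open>c / 2\<close>: the hypothesis on \<open>t\<close> is squared. \<open>b / 8\<close>: the exponent is halved by the union bound over cells, again by the factor \<open>8\<close>, and again by \<open>k / 2\<close>. \<open>1 / 2\<close>: the power of the supremum.\<close>
  define c2 where "c2 = min (c / 2) (min (b / 8) (1 / 2))"
  have c2: "c2 > 0" "2 * c2 \<le> c" "8 * c2 \<le> b" "c2 \<le> 1 / 2" using b c by (auto simp: c2_def)
  show ?thesis
  proof (rule exI[of _ c1], rule exI[of _ c2], intro conjI allI impI)
    show "c1 > 0" using c1(1) by linarith
    show "c2 > 0" by (rule c2(1))
    fix M :: "'w measure" and a :: "nat ^ 3 \<Rightarrow> 'w \<Rightarrow> real" and n :: nat and r u :: real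
      and k :: nat and A :: "nat \<Rightarrow> (real ^ 3 \<Rightarrow> real) set" and t :: real
    assume M: "prob_space M" and n: "n \<ge> 1" and iid: "iid_std_gaussian M (multi_indices n) a"
      and r: "r \<ge> 1 / sqrt (real n)" and u: "u \<ge> 1 / sqrt (real n)" and k: "k \<ge> 1"
      and cls: "class_E \<U> r u k A"
      and t: "t \<ge> c1 * sqrt (ln (2 * u * sqrt (real n))) * exp (- c2 * r\<^sup>2 * real n)"
    interpret prob_space M by fact
    have rn: "r * sqrt n \<ge> 1" and un: "u * sqrt n \<ge> 1" using r u n by (auto simp: field_simps)
    have r0: "r > 0"
    proof -
      have "0 < 1 / sqrt (real n)" using n by simp
      then show ?thesis using r by linarith
    qed
    obtain U where U': "\<forall>i\<in>{1..k}. compact (U i) \<and> U i \<subseteq> \<U> \<and>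
           A i \<in> sets (restriction_algebra (U i)) \<and> (\<exists>x\<in>S2. U i \<subseteq> sphere_cap u x)"
        and U_sep: "\<forall>i\<in>{1..k}. \<forall>j\<in>{1..k}. i \<noteq> j \<longrightarrow> (\<forall>x\<in>U i. \<forall>y\<in>U j. sphere_dist x y \<ge> r)"
      using cls unfolding class_E_def by (elim conjE exE) (rule that)
    have U: "U i \<subseteq> \<U>" "A i \<in> sets (restriction_algebra (U i))" "\<exists>x\<in>S2. U i \<subseteq> sphere_cap u x"
      if "i \<in> {1..k}" for i
      using bspec[OF U' that] by simp_all
    have inc: "increasing_event (A i)" if "i \<in> {1..k}" for i
      using cls that unfolding class_E_def by simp
    have US: "U i \<subseteq> S2" "\<And>x k. x \<in> U i \<Longrightarrow> x $ k \<ge> \<delta>" if "i \<in> {1..k}" for i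
      using U(1)[OF that] assms(2) \<delta>(2) by auto
    have US': "\<forall>i\<in>{1..k}. U i \<subseteq> S2 \<and> (\<forall>x\<in>U i. \<forall>k. x $ k \<ge> \<delta>)" using US by blast
    \<comment> \<open>Truncation radius: a fixed fraction of the separation of the centres.\<close>
    define \<rho> where "\<rho> = \<delta> * (r * sqrt n) / 4"
    have \<rho>: "\<rho> \<ge> 0" using \<delta>(1) rn by (simp add: \<rho>_def)
    define Q where "Q = t\<^sup>2 * exp (c * r\<^sup>2 * n)"
    define l where "l = ln (2 * (u * sqrt n))"
    have l: "l > 0" using un by (simp add: l_def)
    have t_pos: "t > 0"
    proof -
      have "0 < c1 * sqrt l * exp (- c2 * r\<^sup>2 * real n)" using c1(1) l by simp
      then show ?thesis using t by (simp add: l_def mult.assoc)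
    qed
    have Q: "Q \<ge> c1\<^sup>2 * l"
    proof -
      \<comment> \<open>Squaring the lower bound on \<open>t\<close> gives the rate \<open>2 * c2\<close>, which \<open>c\<close> dominates.\<close>
      have "(c1 * sqrt l * exp (- c2 * r\<^sup>2 * real n))\<^sup>2 \<le> t\<^sup>2"
        using t c1(1) l by (intro power_mono) (simp_all add: l_def mult.assoc)
      moreover have "(c1 * sqrt l * exp (- c2 * r\<^sup>2 * real n))\<^sup>2 = c1\<^sup>2 * l * exp (- (2 * c2 * r\<^sup>2 * n))"
        using l by (simp add: power_mult_distrib flip: exp_double)
      ultimately have "c1\<^sup>2 * l * exp (- (2 * c2 * r\<^sup>2 * n)) * exp (c * r\<^sup>2 * n) \<le> Q"
        unfolding Q_def by (intro mult_right_mono) auto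
      moreover have "c1\<^sup>2 * l * exp (- (2 * c2 * r\<^sup>2 * n)) * exp (c * r\<^sup>2 * n) = c1\<^sup>2 * l * exp ((c - 2 * c2) * (r\<^sup>2 * n))"
        by (simp add: algebra_simps flip: exp_add)
      moreover have "c1\<^sup>2 * l * 1 \<le> c1\<^sup>2 * l * exp ((c - 2 * c2) * (r\<^sup>2 * n))"
        using l c2(2) by (intro mult_left_mono) auto
      ultimately show ?thesis by linarith
    qed
    have Q2: "t\<^sup>2 * exp (c2 * r\<^sup>2 * n) \<le> Q"
    proof -
      have "c2 * (r\<^sup>2 * n) \<le> c * (r\<^sup>2 * n)" using c2(1,2) by (intro mult_right_mono) auto
      then show ?thesis unfolding Q_def by (intro mult_left_mono) (auto simp: mult.assoc)
    qed
    \<comment> \<open>Probability of a large error per set, after paying for the choice of the cells.\<close>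
    define \<beta> where "\<beta> = exp (- (b / 2 * Q))"
    have absorbed: "2 * (C * (u * sqrt n)) ^ 3 * exp (- (b * Q)) \<le> \<beta>" "b / 2 * Q \<ge> 6 * ln 2"
      unfolding \<beta>_def using net_union_bound_absorbed[OF b C un _ c1(2)] c1(1) Q unfolding l_def by auto
    have \<beta>: "0 < \<beta>" "\<beta> \<le> 1" 
    proof -
      have "0 \<le> 6 * ln (2 :: real)" by simp
      then have "0 \<le> b / 2 * Q" using absorbed(2) by (rule order_trans)
      then show "0 < \<beta>" "\<beta> \<le> 1" unfolding \<beta>_def by (simp_all only: exp_gt_zero exp_le_one_iff neg_le_0_iff_le)
    qed

    define S where "S i = near_indices n \<rho> (U i)" for i
    have sep: "norm (centre n x - centre n y) \<ge> 2 / 3 * \<delta>"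
      if "i \<in> {1..k}" "j \<in> {1..k}" "i \<noteq> j" "x \<in> U i" "y \<in> U j" for i j x y
    proof -
      have "2 / 3 * \<delta> * 1 \<le> 2 / 3 * \<delta> * (r * sqrt n)" using \<delta>(1) rn by (intro mult_left_mono) auto
      also have "\<dots> \<le> norm (centre n x - centre n y)"
        by (rule centres_separated[OF \<delta>(1) US' U_sep that])
      finally show ?thesis by simp
    qed
    have disj: "disjoint_family_on S {1..k}"
      unfolding S_def \<rho>_def by (rule disjoint_near_indices[OF n r0 \<delta>(1) US' U_sep])
    have S_sub: "S i \<subseteq> multi_indices n" for i by (auto simp: S_def near_indices_def)

    define F where "F i = {\<omega> \<in> space M. kostlan n a \<omega> \<in> A i}" for i
    define G where "G i = {\<omega> \<in> space M. (\<lambda>x. partial_kostlan n (S i) a \<omega> x + t / 2) \<in> A i}" for i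
    define H where "H i = {\<omega> \<in> space M. (\<lambda>x. kostlan n a \<omega> x + t) \<in> A i}" for i
    define bad where "bad i = {\<omega>. \<exists>x\<in>U i. \<bar>partial_kostlan n (multi_indices n - S i) a \<omega> x\<bar> > t / 2}" for i
    have path: "kostlan n a \<omega> \<in> C_S2" "(\<lambda>x. kostlan n a \<omega> x + t) \<in> C_S2" for \<omega>
      using partial_kostlan_C_S2[of n "multi_indices n" a \<omega> 0] partial_kostlan_C_S2[of n "multi_indices n" a \<omega> t]
      by (simp_all add: kostlan_eq_partial)
    have good: "\<bar>kostlan n a \<omega> x - partial_kostlan n (S i) a \<omega> x\<bar> \<le> t / 2"
      if "\<omega> \<notin> bad i" "x \<in> U i" for \<omega> i x
      using that partial_kostlan_split[OF S_sub[of i], of a \<omega> x] by (auto simp: bad_def not_less)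
    have FG: "F i \<subseteq> G i \<union> bad i" if i: "i \<in> {1..k}" for i
    proof
      fix \<omega> assume \<omega>: "\<omega> \<in> F i"
      show "\<omega> \<in> G i \<union> bad i"
      proof (cases "\<omega> \<in> bad i")
        case False
        have "(\<lambda>x. partial_kostlan n (S i) a \<omega> x + t / 2) \<in> A i"
        proof (rule increasing_event_mono_on[OF U(2)[OF i] inc[OF i] US(1)[OF i] _ path(1) partial_kostlan_C_S2])
          show "kostlan n a \<omega> \<in> A i" using \<omega> by (simp add: F_def)
          show "kostlan n a \<omega> x \<le> partial_kostlan n (S i) a \<omega> x + t / 2" if "x \<in> U i" for x
            using good[OF False that] by linarith
        qed
        then show ?thesis using \<omega> by (simp add: F_def G_def)
      qed simp
    qed
    have GH: "G i \<subseteq> H i \<union> bad i" if i: "i \<in> {1..k}" for i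
    proof
      fix \<omega> assume \<omega>: "\<omega> \<in> G i"
      show "\<omega> \<in> H i \<union> bad i"
      proof (cases "\<omega> \<in> bad i")
        case False
        have "(\<lambda>x. kostlan n a \<omega> x + t) \<in> A i"
        proof (rule increasing_event_mono_on[OF U(2)[OF i] inc[OF i] US(1)[OF i] _ partial_kostlan_C_S2 path(2)])
          show "(\<lambda>x. partial_kostlan n (S i) a \<omega> x + t / 2) \<in> A i" using \<omega> by (simp add: G_def)
          show "partial_kostlan n (S i) a \<omega> x + t / 2 \<le> kostlan n a \<omega> x + t" if "x \<in> U i" for x
            using good[OF False that] by linarith
        qed
        then show ?thesis using \<omega> by (simp add: G_def H_def)
      qed simp
    qed
    have G_sets: "G i \<in> sets M" if i: "i \<in> {1..k}" for i
      unfolding G_def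
      by (rule partial_kostlan_events(1)[OF M iid, of "{1..k}" S A U]) (use S_sub disj U(2) i in auto)
    have H_sets: "H i \<in> sets M" if i: "i \<in> {1..k}" for i
      unfolding H_def kostlan_eq_partial
      by (rule partial_kostlan_events(1)[OF M iid, of "{i}" "\<lambda>_. multi_indices n" A U i])
         (use U(2) i in \<open>auto simp: disjoint_family_on_def\<close>)
    have G_indep: "prob {\<omega> \<in> space M. \<forall>i\<in>T. \<omega> \<in> G i} = (\<Prod>i\<in>T. prob (G i))" if T: "T \<subseteq> {1..k}" for T
    proof -
      have "{\<omega> \<in> space M. \<forall>i\<in>T. \<omega> \<in> G i} =
          {\<omega> \<in> space M. \<forall>i\<in>T. (\<lambda>x. partial_kostlan n (S i) a \<omega> x + t / 2) \<in> A i}" by (auto simp: G_def)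
      moreover have "disjoint_family_on S T" using disj T by (rule disjoint_family_on_mono[rotated])
      ultimately show ?thesis unfolding G_def
        using T by (simp only:) (rule partial_kostlan_events(2)[OF M iid, of T S A U],
            use S_sub U(2) finite_subset[OF T] in auto)
    qed
    have rare: "\<exists>E\<in>sets M. {\<omega> \<in> space M. \<forall>i\<in>T. \<omega> \<in> bad i} \<subseteq> E \<and> prob E \<le> \<beta> ^ card T"
      if T: "T \<subseteq> {1..k}" "T \<noteq> {}" for T
    proof -
      have fin: "finite T" using T(1) finite_subset by blast
      have "\<exists>E\<in>sets M. {\<omega> \<in> space M. \<forall>i\<in>T. \<exists>x\<in>U i.
            \<bar>partial_kostlan n (multi_indices n - near_indices n \<rho> (U i)) a \<omega> x\<bar> > t / 2} \<subseteq> E \<and>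
          prob E \<le> (2 * ((4 / \<delta> + 2) * (u * sqrt n)) ^ 3 *
            exp (- ((t / 2)\<^sup>2 * exp (\<rho>\<^sup>2 / 72) / (48 * exp 3042 * K)))) ^ card T"
      proof (rule truncation_errors_tail[OF M iid n \<delta>(1) un fin T(2) _ _ _ K0 _ \<rho>])
        show "U i \<subseteq> S2" "\<exists>c\<in>S2. U i \<subseteq> sphere_cap u c" if "i \<in> T" for i
          using that T(1) US(1) U(3) by blast+
        show "\<delta> \<le> x $ k" if "i \<in> T" "x \<in> U i" for i x k
          using that T(1) US(2) by blast
        show "(\<Sum>i\<in>T. exp (- norm (z - centre n (x i)))) \<le> K" if "\<And>i. i \<in> T \<Longrightarrow> x i \<in> U i" for x z
        proof (rule K[OF fin])
          fix i j assume "i \<in> T" "j \<in> T" "i \<noteq> j"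
          then show "norm (centre n (x i) - centre n (x j)) \<ge> 2 / 3 * \<delta>"
            using T(1) that[of i] that[of j] sep[of i j "x i" "x j"] by blast
        qed
      qed (use t_pos in simp)
      then obtain E where E: "E \<in> sets M" "{\<omega> \<in> space M. \<forall>i\<in>T. \<omega> \<in> bad i} \<subseteq> E"
          "prob E \<le> (2 * (C * (u * sqrt n)) ^ 3 *
            exp (- ((t / 2)\<^sup>2 * exp (\<rho>\<^sup>2 / 72) / (48 * exp 3042 * K)))) ^ card T"
        unfolding bad_def S_def C_def mem_Collect_eq by blast
      have "\<rho>\<^sup>2 / 72 = c * r\<^sup>2 * n"
        by (simp add: \<rho>_def c_def power_mult_distrib power_divide)
      moreover have "(t / 2)\<^sup>2 * exp (c * r\<^sup>2 * n) / (48 * exp 3042 * K) = b * Q"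
        unfolding b_def Q_def power_divide by simp
      ultimately have "prob E \<le> (2 * (C * (u * sqrt n)) ^ 3 * exp (- (b * Q))) ^ card T" using E(3) by (simp only:)
      also have "\<dots> \<le> \<beta> ^ card T"
        using absorbed(1) C un by (intro power_mono mult_nonneg_nonneg) auto
      finally show ?thesis using E(1,2) by blast
    qed
    note decoupling = decoupling_of_rare_errors[OF M k G_sets G_indep H_sets rare FG GH \<beta>]
    have F_eq: "{\<omega> \<in> space M. \<forall>i\<in>{1..k}. \<omega> \<in> F i} = {\<omega> \<in> space M. \<forall>i\<in>{1..k}. kostlan n a \<omega> \<in> A i}"
      by (auto simp: F_def)
    define X where "X = t\<^sup>2 * exp (c2 * r\<^sup>2 * n)"
    have X: "0 \<le> X" "X \<le> Q" using Q2 by (auto simp: X_def)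
    show "prob {\<omega> \<in> space M. \<forall>i\<in>{1..k}. kostlan n a \<omega> \<in> A i}
        \<le> (\<Prod>i\<in>{1..k}. prob {\<omega> \<in> space M. (\<lambda>x. kostlan n a \<omega> x + t) \<in> A i})
          + c1 * real k * exp (- c2 * t\<^sup>2 * exp (c2 * r\<^sup>2 * real n))"
    proof -
      have "c2 * X \<le> b / 2 * Q" using c2 X b by (intro mult_mono) auto
      then have "\<beta> \<le> exp (- (c2 * X))" by (simp add: \<beta>_def)
      then have "2 * (k * \<beta>) \<le> c1 * (k * exp (- (c2 * X)))"
        using c1(1) \<beta>(1) by (intro mult_mono) auto
      then show ?thesis using decoupling(1) unfolding F_eq H_def X_def by (simp add: mult.assoc)
    qed
    define p where "p = (SUP i\<in>{1..k}. prob (H i))"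
    have p0: "p \<ge> 0"
    proof -
      have "0 \<le> prob (H 1)" by simp
      also have "\<dots> \<le> p" unfolding p_def using k by (intro cSUP_upper) auto
      finally show ?thesis .
    qed
    \<comment> \<open>If \<open>c1 * p\<close> exceeds 1 the bound is trivial; otherwise lowering the exponent from \<open>k / 2\<close> to \<open>c2 * k\<close> enlarges the power.\<close>
    have "prob {\<omega> \<in> space M. \<forall>i\<in>{1..k}. kostlan n a \<omega> \<in> A i} \<le> (c1 * p) powr (c2 * k) + c1 * exp (- (c2 * k * X))"
    proof (cases "c1 * p \<ge> 1")
      case True
      then have "1 \<le> (c1 * p) powr (c2 * k)" using c2(1) by (intro ge_one_powr_ge_zero) auto
      moreover have "0 \<le> c1 * exp (- (c2 * k * X))" using c1(1) by simp
      ultimately show ?thesis using prob_le_1[of "{\<omega> \<in> space M. \<forall>i\<in>{1..k}. kostlan n a \<omega> \<in> A i}"] by linarith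
    next
      case False
      have "(8 * p) powr (k / 2) \<le> (c1 * p) powr (k / 2)"
        using c1(1) p0 by (intro powr_mono2 mult_right_mono) auto
      also have "\<dots> \<le> (c1 * p) powr (c2 * k)"
        using False c1(1) p0 c2(4) by (intro powr_mono') (auto simp: mult_right_mono[of c2 "1 / 2" "real k", simplified])
      finally have 1: "(8 * p) powr (k / 2) \<le> (c1 * p) powr (c2 * k)" .
      have "8 * \<beta> \<le> exp (- (b / 4 * Q))"
      proof -
        have "exp (3 * ln 2) = (8 :: real)" using exp_of_nat_mult[of 3 "ln 2 :: real"] by simp
        then have "8 * \<beta> = exp (3 * ln 2) * exp (- (b / 2 * Q))" by (simp only: \<beta>_def)
        also have "\<dots> = exp (3 * ln 2 - b / 2 * Q)" by (simp only: diff_conv_add_uminus exp_add)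
        also have "\<dots> \<le> exp (- (b / 4 * Q))" using absorbed(2) by simp
        finally show ?thesis .
      qed
      then have "(8 * \<beta>) powr (k / 2) \<le> exp (- (b / 4 * Q)) powr (k / 2)"
        using \<beta>(1) by (intro powr_mono2) auto
      also have "\<dots> = exp (- (b / 8 * k * Q))" by (simp add: powr_def mult_ac)
      also have "\<dots> \<le> 1 * exp (- (c2 * k * X))"
      proof -
        have "c2 * k * X \<le> b / 8 * k * Q" using c2 X b by (intro mult_mono mult_right_mono) auto
        then show ?thesis by simp
      qed
      also have "\<dots> \<le> c1 * exp (- (c2 * k * X))" using c1(1) by (intro mult_right_mono) auto
      finally have 2: "(8 * \<beta>) powr (k / 2) \<le> c1 * exp (- (c2 * k * X))" .
      show ?thesis using decoupling(2) 1 2 unfolding F_eq p_def[symmetric] by linarith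
    qed
    then show "prob {\<omega> \<in> space M. \<forall>i\<in>{1..k}. kostlan n a \<omega> \<in> A i}
        \<le> (c1 * (SUP i\<in>{1..k}. prob {\<omega> \<in> space M. (\<lambda>x. kostlan n a \<omega> x + t) \<in> A i})) powr (c2 * real k)
          + c1 * exp (- c2 * real k * t\<^sup>2 * exp (c2 * r\<^sup>2 * real n))"
      unfolding p_def H_def X_def by (simp add: mult.assoc)
  qed
qed

end
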